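(* Fix any constant $c_0\in(0,1)$. Consider one of the following three models for the observed matrix $A$ (defined in the context), along a sequence $n\to\infty$ in which the parameters may depend on $n$ as allowed in the model: (1) the $\mathbb{Z}_2$ Synchronization model; (2) the Censored Block Model with $I^*=o(1)$; (3) the Stochastic Block Model with $0<q<p<1-c_0$. If $nI^*\to\infty$ as $n\to\infty$, then $$\inf_{\widehat\sigma}\ \sup_{\sigma\in\Theta(n)}\ \mathbb{E}_{\sigma}\,\mathrm{err}(\widehat\sigma,\sigma)\ \ge\ \exp\left[-\big(1+o(1)\big)\bar n I^*\right],$$ where $\mathbb{E}_\sigma$ denotes expectation under the distribution of $A$ when $\sigma$ is the ground-truth label vector, and the infimum is over all estimators $\widehat\sigma\in\{\pm1\}^n$ (measurable functions of $A$).
   Context: Models. Given a label vector $\sigma\in\{\pm1\}^n$, a symmetric random matrix $A\in\mathbb{R}^{n\times n}$ has independent entries $\{A_{ij}: i\le j\}$ with: - $\mathbb{Z}_2$ Synchronization: $A_{ij}\sim N(\sigma_i\sigma_j,\tau^2)$, with $\tau>0$ allowed to depend on $n$. - Censored Block Model: $A_{ij}=\sigma_i\sigma_j$ with probability $\alpha(1-\epsilon)$, $A_{ij}=-\sigma_i\sigma_j$ with probability $\alpha\epsilon$, $A_{ij}=0$ with probability $1-\alpha$; $\alpha\in(0,1]$ may depend on $n$ and $\epsilon\in(0,\tfrac12)$ is a constant. - Stochastic Block Model: $A_{ij}\sim\mathrm{Ber}(p)$ if $\sigma_i\sigma_j=1$ and $A_{ij}\sim\mathrm{Ber}(q)$ if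 $\sigma_i\sigma_j=-1$; $0<q<p<1$ may depend on $n$. Signal-to-noise ratio: $I^*=(2\tau^2)^{-1}$ for $\mathbb{Z}_2$ Synchronization; $I^*=\big(\sqrt{\alpha(1-\epsilon)}-\sqrt{\alpha\epsilon}\big)^2$ for the Censored Block Model; $I^*=-2\log\big[\sqrt{pq}+\sqrt{(1-p)(1-q)}\big]$ for the Stochastic Block Model. $\bar n=n$ for $\mathbb{Z}_2$ Synchronization and the Censored Block Model, and $\bar n=n/2$ for the Stochastic Block Model. Parameter space: $\Theta(n)=\{\pm1\}^n$ for $\mathbb{Z}_2$ Synchronization and the Censored Block Model. For the Stochastic Block Model, $\Theta(n)=\{\sigma\in\{\pm1\}^n:\ \ell_1(\sigma)\in[\tfrac{n}{2\beta},\tfrac{n\beta}{2}]\}$, where $\ell_1(\sigma)$ is the number of $1$'s in $\sigma$ and $\beta$ is any number larger than $1+C/n$ with $C>0$ a large enough numerical constant. Error: $\mathrm{err}(\sigma,\sigma')=\min_{g\in\{\pm1\}}\frac1n\sum_{i=1}^n\mathbf{1}\{g\sigma_i\ne\sigma_i'\}$. *)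

theory Defs
  imports "HOL-Probability.Probability" "HOL-Library.Landau_Symbols"
begin

text \<open>
  Vectors in \<open>\<real>\<^sup>n\<close> and matrices in \<open>\<real>\<^sup>n\<^sup>\<times>\<^sup>n\<close> are extensional functions on
  \<open>{..<n}\<close> and \<open>{..<n} \<times> {..<n}\<close>, so that \<open>n\<close> may vary.
\<close>

definition labels :: "nat \<Rightarrow> (nat \<Rightarrow> real) set" where
  "labels n = {..<n} \<rightarrow>\<^sub>E {-1, 1}"

definition matrix_space :: "nat \<Rightarrow> (nat \<times> nat \<Rightarrow> real) measure" where
  "matrix_space n = PiM ({..<n} \<times> {..<n}) (\<lambda>_. borel)"

definition symmetrize :: "nat \<Rightarrow> (nat \<times> nat \<Rightarrow> real) \<Rightarrow> (nat \<times> nat \<Rightarrow> real)" where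
  "symmetrize n x = (\<lambda>(i, j) \<in> {..<n} \<times> {..<n}. if i \<le> j then x (i, j) else x (j, i))"

text \<open>
  Law of the observed matrix under \<open>\<sigma>\<close>: the entries with \<open>i \<le> j\<close> (diagonal included) are
  independent with laws \<open>D (\<sigma> i * \<sigma> j)\<close>; the other entries are determined by symmetry.
\<close>

definition matrix_law :: "nat \<Rightarrow> (real \<Rightarrow> real measure) \<Rightarrow> (nat \<Rightarrow> real) \<Rightarrow> (nat \<times> nat \<Rightarrow> real) measure" where
  "matrix_law n D \<sigma> =
     distr (PiM {(i, j). i \<le> j \<and> j < n} (\<lambda>(i, j). D (\<sigma> i * \<sigma> j))) (matrix_space n) (symmetrize n)"

text \<open>In the three entry laws below, \<open>s\<close> stands for the product \<open>\<sigma> i * \<sigma> j\<close>.\<close>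

definition z2_entry :: "real \<Rightarrow> real \<Rightarrow> real measure" where
  "z2_entry \<tau> s = density lborel (normal_density s \<tau>)"

definition cbm_entry :: "real \<Rightarrow> real \<Rightarrow> real \<Rightarrow> real measure" where
  "cbm_entry \<alpha> \<epsilon> s =
     distr (pmf_of_list [(s, \<alpha> * (1 - \<epsilon>)), (- s, \<alpha> * \<epsilon>), (0, 1 - \<alpha>)]) borel (\<lambda>x. x)"

definition sbm_entry :: "real \<Rightarrow> real \<Rightarrow> real \<Rightarrow> real measure" where
  "sbm_entry p q s = distr (bernoulli_pmf (if s = 1 then p else q)) borel of_bool"

definition z2_snr :: "real \<Rightarrow> real" where
  "z2_snr \<tau> = inverse (2 * \<tau>\<^sup>2)"

definition cbm_snr :: "real \<Rightarrow> real \<Rightarrow> real" where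
  "cbm_snr \<alpha> \<epsilon> = (sqrt (\<alpha> * (1 - \<epsilon>)) - sqrt (\<alpha> * \<epsilon>))\<^sup>2"

definition sbm_snr :: "real \<Rightarrow> real \<Rightarrow> real" where
  "sbm_snr p q = - 2 * ln (sqrt (p * q) + sqrt ((1 - p) * (1 - q)))"

definition sbm_labels :: "nat \<Rightarrow> real \<Rightarrow> (nat \<Rightarrow> real) set" where
  "sbm_labels n \<beta> =
     {\<sigma> \<in> labels n. real (card {i \<in> {..<n}. \<sigma> i = 1}) \<in> {real n / (2 * \<beta>) .. real n * \<beta> / 2}}"

definition err :: "nat \<Rightarrow> (nat \<Rightarrow> real) \<Rightarrow> (nat \<Rightarrow> real) \<Rightarrow> real" where
  "err n \<sigma> \<sigma>' = (MIN g \<in> {-1, 1}. 1 / real n * (\<Sum>i<n. of_bool (g * \<sigma> i \<noteq> \<sigma>' i)))"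

definition estimators :: "nat \<Rightarrow> ((nat \<times> nat \<Rightarrow> real) \<Rightarrow> (nat \<Rightarrow> real)) set" where
  "estimators n = matrix_space n \<rightarrow>\<^sub>M count_space (labels n)"

text \<open>
  The error lies in \<open>{0..1}\<close>, so the real-valued infimum and supremum are the intended ones
  as soon as \<open>\<Theta>\<close> is nonempty and \<open>D s\<close> is a probability measure on \<open>borel\<close> for every \<open>s\<close>.
\<close>

definition minimax_risk :: "nat \<Rightarrow> (real \<Rightarrow> real measure) \<Rightarrow> (nat \<Rightarrow> real) set \<Rightarrow> real" where
  "minimax_risk n D \<Theta> =
     (INF est \<in> estimators n. SUP \<sigma> \<in> \<Theta>. \<integral>A. err n (est A) \<sigma> \<partial>matrix_law n D \<sigma>)"

end

theory Submission
  imports Defs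
begin

text \<open>
  Restrict the labels to a class in which two thirds of the nodes have known labels. The known nodes
  resolve the global sign, so that the error dominates the fraction of free nodes that are
  misclassified. The class is chosen such that from each of its members a constant fraction of the
  single label flips stay inside; averaging over the class and pairing each member with its flips
  reduces the problem, up to a constant factor, to testing \<open>\<sigma>\<close> against \<open>\<sigma>\<close> with one flipped label.

  For this test, let \<open>Q\<close> be the normalised geometric mean of the laws of an entry under the two signs.
  Both laws have densities \<open>\<rho> exp (\<plusminus>h)\<close> with respect to \<open>Q\<close>, so the sum of the two error probabilities is at
  least \<open>\<rho>\<^sup>n\<^sup>-\<^sup>1 E exp (- \<bar>\<Lambda>\<bar>)\<close>, where \<open>\<Lambda>\<close> is a signed sum of \<open>n - 1\<close> independent copies of \<open>h\<close>. Jensen's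
  inequality bounds this below by \<open>\<rho>\<^sup>n\<^sup>-\<^sup>1 exp (- sqrt (E \<Lambda>\<^sup>2))\<close>. In all three models \<open>\<rho>\<^sup>n\<close> is
  \<open>exp (- (1 + o(1)) X)\<close> with \<open>X\<close> the exponent of the theorem, and \<open>E \<Lambda>\<^sup>2 = O(X)\<close>, which is
  negligible as \<open>X \<longlongrightarrow> \<infinity>\<close>.
\<close>

subsection \<open>Testing product measures\<close>

text \<open>Tonelli makes both sides agree on boxes, and boxes determine a finite product of
  sigma-finite measures. Sigma-finiteness is asked at every index, also outside \<open>I\<close>, to
  match the locale \<open>product_sigma_finite\<close>.\<close>

lemma PiM_density:
  fixes f :: "'i \<Rightarrow> 'a \<Rightarrow> ennreal"
  assumes I: "finite I"
    and M: "\<And>i. sigma_finite_measure (M i)" "\<And>i. sigma_finite_measure (density (M i) (f i))"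
    and f: "\<And>i. i \<in> I \<Longrightarrow> f i \<in> borel_measurable (M i)"
  shows "PiM I (\<lambda>i. density (M i) (f i)) = density (PiM I M) (\<lambda>x. \<Prod>i\<in>I. f i (x i))"
proof -
  interpret M: product_sigma_finite M using M(1) by (intro product_sigma_finite.intro)
  interpret D: product_sigma_finite "\<lambda>i. density (M i) (f i)"
    using M(2) by (intro product_sigma_finite.intro)
  have mf: "(\<lambda>x. \<Prod>i\<in>I. f i (x i)) \<in> borel_measurable (PiM I M)"
    using f by measurable
  have sets_eq: "sets (PiM I M) = sets (PiM I (\<lambda>i. density (M i) (f i)))"
    by (intro sets_PiM_cong) auto
  show ?thesis
  proof (rule D.PiM_eqI[OF I, symmetric])
    show "sets (density (PiM I M) (\<lambda>x. \<Prod>i\<in>I. f i (x i))) = sets (PiM I (\<lambda>i. density (M i) (f i)))"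
      using sets_eq by simp
    fix A assume A: "\<And>i. i \<in> I \<Longrightarrow> A i \<in> sets (density (M i) (f i))"
    then have Ai: "Pi\<^sub>E I A \<in> sets (PiM I M)"
      using I by (intro sets_PiM_I_finite) auto
    have "density (PiM I M) (\<lambda>x. \<Prod>i\<in>I. f i (x i)) (Pi\<^sub>E I A)
        = (\<integral>\<^sup>+x. (\<Prod>i\<in>I. f i (x i)) * indicator (Pi\<^sub>E I A) x \<partial>PiM I M)"
      by (rule emeasure_density[OF mf Ai])
    also have "\<dots> = (\<integral>\<^sup>+x. (\<Prod>i\<in>I. f i (x i) * indicator (A i) (x i)) \<partial>PiM I M)"
    proof (rule nn_integral_cong)
      fix x assume x: "x \<in> space (PiM I M)"
      then have "indicator (Pi\<^sub>E I A) x = (\<Prod>i\<in>I. indicator (A i) (x i) :: ennreal)"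
        using I by (auto simp: indicator_def space_PiM PiE_iff)
      then show "(\<Prod>i\<in>I. f i (x i)) * indicator (Pi\<^sub>E I A) x = (\<Prod>i\<in>I. f i (x i) * indicator (A i) (x i))"
        by (simp add: prod.distrib)
    qed
    also have "\<dots> = (\<Prod>i\<in>I. \<integral>\<^sup>+x. f i x * indicator (A i) x \<partial>M i)"
      using A f I by (intro M.product_nn_integral_prod) auto
    also have "\<dots> = (\<Prod>i\<in>I. emeasure (density (M i) (f i)) (A i))"
      using A f by (intro prod.cong refl emeasure_density[symmetric]) auto
    finally show "density (PiM I M) (\<lambda>x. \<Prod>i\<in>I. f i (x i)) (Pi\<^sub>E I A)
        = (\<Prod>i\<in>I. emeasure (density (M i) (f i)) (A i))" .
  qed
qed

text \<open>Independence turns each off-diagonal term into the squared mean of \<open>h\<close>. In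
  the block model this mean is in general nonzero, so the square of the sum of the signs enters the
  bound; balanced labels will keep it small.\<close>

lemma PiM_second_moment:
  fixes h :: "'a \<Rightarrow> real" and s :: "'i \<Rightarrow> real"
  assumes I: "finite I" "J \<subseteq> I" and M: "\<And>i. prob_space (M i)"
    and Q: "\<And>i. i \<in> J \<Longrightarrow> M i = Q" "prob_space Q"
    and h: "h \<in> borel_measurable Q" "integrable Q (\<lambda>x. (h x)\<^sup>2)"
    and s: "\<And>i. i \<in> J \<Longrightarrow> (s i)\<^sup>2 = 1"
  defines "v \<equiv> \<integral>x. (h x)\<^sup>2 \<partial>Q"
  shows "integrable (PiM I M) (\<lambda>x. (\<Sum>i\<in>J. s i * h (x i))\<^sup>2)"
    and "(\<integral>x. (\<Sum>i\<in>J. s i * h (x i))\<^sup>2 \<partial>PiM I M) \<le> (real (card J) + (\<Sum>i\<in>J. s i)\<^sup>2) * v"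
proof -
  interpret Q: prob_space Q by fact
  interpret M: product_prob_space M using M by (rule product_prob_spaceI)
  have J: "finite J" using I finite_subset by auto
  have inth: "integrable Q h"
    using Q.square_integrable_imp_integrable[OF h] .
  define \<mu> where "\<mu> = integral\<^sup>L Q h"
  have mv: "\<mu>\<^sup>2 \<le> v"
    using Q.variance_positive[of h] Q.variance_eq[OF inth h(2)] by (simp add: v_def \<mu>_def)
  have *: "integrable (PiM I M) (\<lambda>x. h (x i) * h (x j)) \<and>
     (\<integral>x. h (x i) * h (x j) \<partial>PiM I M) = (if i = j then v else \<mu>\<^sup>2)"
    if ij: "i \<in> J" "j \<in> J" for i j
  proof -
    \<comment> \<open>Factors \<open>1\<close> away from \<open>i\<close> and \<open>j\<close> make
      \<open>h (x i) * h (x j)\<close> a product over all of \<open>I\<close>, to which the integral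
      of a product applies; for \<open>i = j\<close> the single factor is a square.\<close>
    define F where "F k = (\<lambda>y. if k = i \<and> k = j then (h y)\<^sup>2 else if k = i \<or> k = j then h y else 1)" for k
    have int: "integrable (M k) (F k)" if "k \<in> I" for k
    proof -
      interpret Mk: prob_space "M k" by fact
      show ?thesis
        using Q(1)[OF ij(1)] Q(1)[OF ij(2)] h(2) inth unfolding F_def
        by (cases "k = i"; cases "k = j") simp_all
    qed
    have eq: "(\<Prod>k\<in>I. F k (x k)) = h (x i) * h (x j)" for x
    proof -
      have "(\<Prod>k\<in>I. F k (x k)) = (\<Prod>k\<in>{i, j}. F k (x k))"
        using I ij by (intro prod.mono_neutral_right) (auto simp: F_def)
      also have "\<dots> = h (x i) * h (x j)"
        by (cases "i = j") (auto simp: F_def power2_eq_square)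
      finally show ?thesis .
    qed
    have "(\<Prod>k\<in>I. integral\<^sup>L (M k) (F k)) = (\<Prod>k\<in>{i, j}. integral\<^sup>L (M k) (F k))"
    proof (rule prod.mono_neutral_right)
      show "\<forall>k\<in>I - {i, j}. integral\<^sup>L (M k) (F k) = 1"
      proof
        fix k assume "k \<in> I - {i, j}"
        then have "F k = (\<lambda>_. 1)" by (auto simp: F_def)
        then show "integral\<^sup>L (M k) (F k) = 1" using prob_space.prob_space[OF M] by simp
      qed
    qed (use I ij in auto)
    also have "\<dots> = (if i = j then v else \<mu>\<^sup>2)"
      using ij Q(1) by (cases "i = j") (auto simp: F_def power2_eq_square \<mu>_def v_def)
    finally have v: "(\<Prod>k\<in>I. integral\<^sup>L (M k) (F k)) = (if i = j then v else \<mu>\<^sup>2)" .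
    show ?thesis
      using M.product_integrable_prod[OF I(1) int] M.product_integral_prod[OF I(1) int]
      unfolding eq v by simp
  qed
  have sq: "(\<Sum>i\<in>J. s i * h (x i))\<^sup>2 = (\<Sum>i\<in>J. \<Sum>j\<in>J. s i * s j * (h (x i) * h (x j)))" for x
    unfolding power2_eq_square sum_product by (intro sum.cong refl) (simp add: mult_ac)
  show "integrable (PiM I M) (\<lambda>x. (\<Sum>i\<in>J. s i * h (x i))\<^sup>2)"
    unfolding sq using * by (intro Bochner_Integration.integrable_sum integrable_mult_right) blast
  have "(\<integral>x. (\<Sum>i\<in>J. s i * h (x i))\<^sup>2 \<partial>PiM I M)
      = (\<Sum>i\<in>J. \<Sum>j\<in>J. s i * s j * (if i = j then v else \<mu>\<^sup>2))"
  proof -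
    have "(\<integral>x. (\<Sum>i\<in>J. \<Sum>j\<in>J. s i * s j * (h (x i) * h (x j))) \<partial>PiM I M)
        = (\<Sum>i\<in>J. \<integral>x. (\<Sum>j\<in>J. s i * s j * (h (x i) * h (x j))) \<partial>PiM I M)"
      using * by (intro Bochner_Integration.integral_sum Bochner_Integration.integrable_sum integrable_mult_right) blast
    also have "\<dots> = (\<Sum>i\<in>J. \<Sum>j\<in>J. \<integral>x. s i * s j * (h (x i) * h (x j)) \<partial>PiM I M)"
      using * by (intro sum.cong refl Bochner_Integration.integral_sum integrable_mult_right) blast
    also have "\<dots> = (\<Sum>i\<in>J. \<Sum>j\<in>J. s i * s j * (if i = j then v else \<mu>\<^sup>2))"
      using * by (intro sum.cong refl) (simp only: integral_mult_right_zero)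
    finally show ?thesis unfolding sq .
  qed
  \<comment> \<open>Every pair contributes the squared mean, and the diagonal additionally the
    variance \<open>v - \<mu>\<^sup>2\<close>.\<close>
  also have "\<dots> = (\<Sum>i\<in>J. \<Sum>j\<in>J. s i * s j * \<mu>\<^sup>2 + (if i = j then s i * s j * (v - \<mu>\<^sup>2) else 0))"
    by (intro sum.cong refl) (auto simp: algebra_simps)
  also have "\<dots> = (\<Sum>i\<in>J. s i)\<^sup>2 * \<mu>\<^sup>2 + (\<Sum>i\<in>J. (s i)\<^sup>2 * (v - \<mu>\<^sup>2))"
    using J by (simp add: sum.distrib power2_eq_square sum_product sum_distrib_right sum_distrib_left mult_ac)
  also have "\<dots> = (\<Sum>i\<in>J. s i)\<^sup>2 * \<mu>\<^sup>2 + real (card J) * (v - \<mu>\<^sup>2)"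
    using s by simp
  also have "\<dots> \<le> (\<Sum>i\<in>J. s i)\<^sup>2 * v + real (card J) * v"
    using mv by (intro add_mono mult_left_mono) auto
  finally show "(\<integral>x. (\<Sum>i\<in>J. s i * h (x i))\<^sup>2 \<partial>PiM I M) \<le> (real (card J) + (\<Sum>i\<in>J. s i)\<^sup>2) * v"
    by (simp add: algebra_simps)
qed

text \<open>Jensen's inequality for \<open>exp (- t)\<close>, through its tangent at the mean of
  \<open>\<bar>X\<bar>\<close>. That mean is at most \<open>sqrt b\<close> since the variance of
  \<open>\<bar>X\<bar>\<close> is nonnegative.\<close>

lemma (in prob_space) expectation_exp_neg_abs_ge:
  fixes X :: "'a \<Rightarrow> real"
  assumes [measurable]: "X \<in> borel_measurable M" and X2: "integrable M (\<lambda>x. (X x)\<^sup>2)"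
    and b: "expectation (\<lambda>x. (X x)\<^sup>2) \<le> b"
  shows "expectation (\<lambda>x. exp (- \<bar>X x\<bar>)) \<ge> exp (- sqrt b)"
proof -
  have X: "integrable M X"
    using square_integrable_imp_integrable[OF assms(1) X2] .
  define a where "a = expectation (\<lambda>x. \<bar>X x\<bar>)"
  have "a\<^sup>2 \<le> expectation (\<lambda>x. \<bar>X x\<bar>\<^sup>2)"
    using variance_positive[of "\<lambda>x. \<bar>X x\<bar>"] variance_eq[of "\<lambda>x. \<bar>X x\<bar>"] X X2
    by (simp add: a_def)
  then have "a \<le> sqrt b"
    using b by (intro real_le_rsqrt) simp
  then have "exp (- sqrt b) \<le> exp (- a)" by simp
  \<comment> \<open>The linear term of the tangent integrates to zero.\<close>
  also have "\<dots> = expectation (\<lambda>x. exp (- a) * (1 - (\<bar>X x\<bar> - a)))"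
    using X by (simp add: a_def[symmetric] prob_space)
  also have "\<dots> \<le> expectation (\<lambda>x. exp (- \<bar>X x\<bar>))"
  proof (rule integral_mono)
    show "integrable M (\<lambda>x. exp (- \<bar>X x\<bar>))"
      by (rule integrable_const_bound[where B = 1]) auto
    show "exp (- a) * (1 - (\<bar>X x\<bar> - a)) \<le> exp (- \<bar>X x\<bar>)" for x
    proof -
      have "exp (- a) * (1 + (a - \<bar>X x\<bar>)) \<le> exp (- a) * exp (a - \<bar>X x\<bar>)"
        by (intro mult_left_mono exp_ge_add_one_self) auto
      then show ?thesis by (simp add: mult_exp_exp algebra_simps)
    qed
  qed (use X in auto)
  finally show ?thesis .
qed

text \<open>Both hypotheses have densities \<open>\<rho> ^ card J * exp (L x)\<close> and
  \<open>\<rho> ^ card J * exp (- L x)\<close> with respect to one reference measure. Reading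
  \<open>B\<close> as the region where a test rejects \<open>M0\<close>, its two error probabilities
  add up to at least the integral of the smaller density, whatever \<open>B\<close> is.\<close>

lemma two_point_bound:
  fixes s :: "'i \<Rightarrow> real" and h :: "'a \<Rightarrow> real"
  assumes I: "finite I" "J \<subseteq> I"
    and M0: "\<And>i. prob_space (M0 i)" and M1: "\<And>i. prob_space (M1 i)" and Q: "prob_space Q"
    and h: "h \<in> borel_measurable Q" "integrable Q (\<lambda>x. (h x)\<^sup>2)" "(\<integral>x. (h x)\<^sup>2 \<partial>Q) \<le> v"
    and \<rho>: "\<rho> > 0"
    and s: "\<And>i. i \<in> J \<Longrightarrow> (s i)\<^sup>2 = 1"
    and eq: "\<And>i. i \<notin> J \<Longrightarrow> M1 i = M0 i"
    and D0: "\<And>i. i \<in> J \<Longrightarrow> M0 i = density Q (\<lambda>x. ennreal (\<rho> * exp (s i * h x)))"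
    and D1: "\<And>i. i \<in> J \<Longrightarrow> M1 i = density Q (\<lambda>x. ennreal (\<rho> * exp (- s i * h x)))"
    and B: "B \<in> sets (PiM I M0)"
  shows "measure (PiM I M0) B + measure (PiM I M1) (space (PiM I M1) - B)
    \<ge> \<rho> ^ card J * exp (- sqrt ((real (card J) + (\<Sum>i\<in>J. s i)\<^sup>2) * v))"
proof -
  have J: "finite J" using I finite_subset by auto
  \<comment> \<open>The reference measure: \<open>Q\<close> on the coordinates that distinguish the
    hypotheses, the common law on the others.\<close>
  define M where "M i = (if i \<in> J then Q else M0 i)" for i
  have pM: "prob_space (M i)" for i using Q M0 by (simp add: M_def)
  interpret N: prob_space "PiM I M" using pM by (intro prob_space_PiM)
  define L where "L x = (\<Sum>i\<in>J. s i * h (x i))" for x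
  have [measurable]: "L \<in> borel_measurable (PiM I M)"
    unfolding L_def
  proof (intro borel_measurable_sum borel_measurable_times borel_measurable_const)
    fix i assume "i \<in> J"
    then have "(\<lambda>x. x i) \<in> PiM I M \<rightarrow>\<^sub>M Q"
      using I measurable_component_singleton[of i I M] by (auto simp: M_def)
    then show "(\<lambda>x. h (x i)) \<in> borel_measurable (PiM I M)" using h(1) by measurable
  qed
  \<comment> \<open>One computation serves both hypotheses: \<open>t = 1\<close> gives
    \<open>M0\<close> and \<open>t = -1\<close> gives \<open>M1\<close>.\<close>
  have dens: "PiM I M' = density (PiM I M) (\<lambda>x. ennreal (\<rho> ^ card J * exp (t * L x)))"
    if M': "\<And>i. prob_space (M' i)" "\<And>i. i \<notin> J \<Longrightarrow> M' i = M0 i"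
      "\<And>i. i \<in> J \<Longrightarrow> M' i = density Q (\<lambda>x. ennreal (\<rho> * exp (t * s i * h x)))" for M' and t :: real
  proof -
    define f where "f i x = (if i \<in> J then ennreal (\<rho> * exp (t * s i * h x)) else 1)" for i x
    have f: "M' i = density (M i) (f i)" for i
    proof (cases "i \<in> J")
      case True
      then have "f i = (\<lambda>x. ennreal (\<rho> * exp (t * s i * h x)))" by (auto simp: f_def)
      then show ?thesis using True M'(3) by (simp add: M_def)
    next
      case False
      then have "f i = (\<lambda>_. 1)" by (auto simp: f_def)
      then show ?thesis using False M'(2) by (simp add: M_def density_1)
    qed
    have "PiM I M' = PiM I (\<lambda>i. density (M i) (f i))" by (simp only: f[symmetric])
    also have "\<dots> = density (PiM I M) (\<lambda>x. \<Prod>i\<in>I. f i (x i))"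
    proof (rule PiM_density[OF I(1)])
      show "sigma_finite_measure (density (M i) (f i))" for i
        using M'(1)[of i] unfolding f[of i] by (simp add: prob_space_imp_sigma_finite)
      show "f i \<in> borel_measurable (M i)" for i
        using h(1) unfolding f_def by (cases "i \<in> J") (simp_all add: M_def)
    qed (use pM in \<open>simp add: prob_space_imp_sigma_finite\<close>)
    also have "(\<lambda>x. \<Prod>i\<in>I. f i (x i)) = (\<lambda>x. ennreal (\<rho> ^ card J * exp (t * L x)))"
    proof
      fix x
      have "(\<Prod>i\<in>I. f i (x i)) = (\<Prod>i\<in>J. f i (x i))"
        using I by (intro prod.mono_neutral_right) (auto simp: f_def)
      also have "\<dots> = (\<Prod>i\<in>J. ennreal (\<rho> * exp (t * s i * h (x i))))"
        by (simp add: f_def)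
      also have "\<dots> = ennreal (\<Prod>i\<in>J. \<rho> * exp (t * s i * h (x i)))"
        using \<rho> by (intro prod_ennreal) auto
      also have "(\<Prod>i\<in>J. \<rho> * exp (t * s i * h (x i))) = \<rho> ^ card J * exp (t * L x)"
        by (simp add: prod.distrib exp_sum[OF J, symmetric] L_def sum_distrib_left mult_ac)
      finally show "(\<Prod>i\<in>I. f i (x i)) = ennreal (\<rho> ^ card J * exp (t * L x))" .
    qed
    finally show ?thesis .
  qed
  have d0: "PiM I M0 = density (PiM I M) (\<lambda>x. ennreal (\<rho> ^ card J * exp (1 * L x)))"
    using M0 D0 by (intro dens) auto
  have d1: "PiM I M1 = density (PiM I M) (\<lambda>x. ennreal (\<rho> ^ card J * exp ((- 1) * L x)))"
    using M1 D1 eq by (intro dens) auto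
  \<comment> \<open>The pointwise minimum of the two densities.\<close>
  define w where "w x = \<rho> ^ card J * exp (- \<bar>L x\<bar>)" for x
  have [measurable]: "w \<in> borel_measurable (PiM I M)" unfolding w_def by measurable
  have w0: "0 \<le> w x" and w_le: "w x \<le> \<rho> ^ card J" for x
    using \<rho> by (auto simp: w_def intro: mult_left_le)
  have intw: "integrable (PiM I M) w"
    using w0 w_le by (intro N.integrable_const_bound[where B = "\<rho> ^ card J"]) auto
  define D where "D t = density (PiM I M) (\<lambda>x. ennreal (\<rho> ^ card J * exp (t * L x)))" for t
  have key: "(\<integral>x. w x * indicator A x \<partial>PiM I M) \<le> measure (D t) A"
    if A: "A \<in> sets (PiM I M)" and t: "t = 1 \<or> t = -1" and D: "prob_space (D t)" for A t
  proof -
    interpret D: prob_space "D t" by fact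
    have "ennreal (\<integral>x. w x * indicator A x \<partial>PiM I M) = (\<integral>\<^sup>+x. ennreal (w x * indicator A x) \<partial>PiM I M)"
      using A w0 intw by (intro nn_integral_eq_integral[symmetric] integrable_real_mult_indicator) auto
    also have "\<dots> \<le> (\<integral>\<^sup>+x. ennreal (\<rho> ^ card J * exp (t * L x)) * indicator A x \<partial>PiM I M)"
      using t \<rho> by (intro nn_integral_mono) (auto simp: w_def indicator_def intro!: ennreal_leI mult_left_mono)
    also have "\<dots> = emeasure (D t) A"
      using A unfolding D_def by (subst emeasure_density) auto
    finally show ?thesis by (simp add: D.emeasure_eq_measure)
  qed
  have D01: "PiM I M0 = D 1" "PiM I M1 = D (-1)"
    unfolding d0 d1 D_def by (rule refl)+
  have pD: "prob_space (D 1)" "prob_space (D (-1))"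
    unfolding D01[symmetric] by (intro prob_space_PiM M0 M1)+
  have BM: "B \<in> sets (PiM I M)" using B d0 by simp
  have sp: "space (PiM I M1) = space (PiM I M)" unfolding d1 by simp
  have "measure (PiM I M0) B + measure (PiM I M1) (space (PiM I M1) - B)
      \<ge> (\<integral>x. w x * indicator B x \<partial>PiM I M) + (\<integral>x. w x * indicator (space (PiM I M) - B) x \<partial>PiM I M)"
    unfolding sp unfolding D01 using BM pD by (intro add_mono key) auto
  also have "(\<integral>x. w x * indicator B x \<partial>PiM I M) + (\<integral>x. w x * indicator (space (PiM I M) - B) x \<partial>PiM I M)
     = (\<integral>x. w x * indicator B x + w x * indicator (space (PiM I M) - B) x \<partial>PiM I M)"
    using BM intw by (intro Bochner_Integration.integral_add[symmetric] integrable_real_mult_indicator) auto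
  also have "\<dots> = (\<integral>x. w x \<partial>PiM I M)"
    by (intro Bochner_Integration.integral_cong) (auto simp: indicator_def)
  also have "\<dots> = \<rho> ^ card J * N.expectation (\<lambda>x. exp (- \<bar>L x\<bar>))"
    unfolding w_def by simp
  finally have ge: "measure (PiM I M0) B + measure (PiM I M1) (space (PiM I M1) - B)
     \<ge> \<rho> ^ card J * N.expectation (\<lambda>x. exp (- \<bar>L x\<bar>))" .
  have sm: "integrable (PiM I M) (\<lambda>x. (L x)\<^sup>2)"
     "N.expectation (\<lambda>x. (L x)\<^sup>2) \<le> (real (card J) + (\<Sum>i\<in>J. s i)\<^sup>2) * (\<integral>x. (h x)\<^sup>2 \<partial>Q)"
    unfolding L_def using I pM Q h s
    by (auto intro!: PiM_second_moment simp: M_def)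
  have "(real (card J) + (\<Sum>i\<in>J. s i)\<^sup>2) * (\<integral>x. (h x)\<^sup>2 \<partial>Q) \<le> (real (card J) + (\<Sum>i\<in>J. s i)\<^sup>2) * v"
    using h(3) by (intro mult_left_mono) auto
  with sm have "N.expectation (\<lambda>x. exp (- \<bar>L x\<bar>)) \<ge> exp (- sqrt ((real (card J) + (\<Sum>i\<in>J. s i)\<^sup>2) * v))"
    by (intro N.expectation_exp_neg_abs_ge) auto
  then have "\<rho> ^ card J * exp (- sqrt ((real (card J) + (\<Sum>i\<in>J. s i)\<^sup>2) * v))
     \<le> \<rho> ^ card J * N.expectation (\<lambda>x. exp (- \<bar>L x\<bar>))"
    using \<rho> by (intro mult_left_mono) auto
  with ge show ?thesis by linarith
qed

subsection \<open>Reduction to single flips\<close>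

lemma labels_cases: "\<sigma> \<in> labels n \<Longrightarrow> i < n \<Longrightarrow> \<sigma> i = 1 \<or> \<sigma> i = -1"
  by (auto simp: labels_def PiE_iff)

lemma labels_prod:
  assumes "\<sigma> \<in> labels n" "i < n" "j < n"
  shows "\<sigma> i * \<sigma> j = 1 \<or> \<sigma> i * \<sigma> j = -1"
  using labels_cases[OF assms(1,2)] labels_cases[OF assms(1,3)] by auto

lemma finite_labels: "finite (labels n)"
  unfolding labels_def by (intro finite_PiE) auto

lemma err_bounds:
  assumes "n > 0"
  shows "0 \<le> err n x \<sigma>" "err n x \<sigma> \<le> 1"
proof -
  have "err n x \<sigma> \<in> (\<lambda>g. 1 / real n * (\<Sum>i<n. of_bool (g * x i \<noteq> \<sigma> i))) ` {-1, 1}"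
    unfolding err_def by (intro Min_in) auto
  then obtain g where g: "err n x \<sigma> = 1 / real n * (\<Sum>i<n. of_bool (g * x i \<noteq> \<sigma> i))" by blast
  have "(\<Sum>i<n. of_bool (g * x i \<noteq> \<sigma> i) :: real) \<le> real (card {..<n}) * 1"
    by (rule sum_bounded_above) auto
  then show "err n x \<sigma> \<le> 1" using assms by (simp add: g divide_le_eq_1)
  show "0 \<le> err n x \<sigma>" by (simp add: g sum_nonneg)
qed

text \<open>
  The nodes from \<open>2 * k + 1\<close> on carry fixed labels, and the free nodes contain \<open>k\<close> or \<open>k + 1\<close> ones. The fixed
  part makes the total number of ones \<open>n div 2\<close> or \<open>n div 2 + 1\<close>, so that these labels are admissible in
  the stochastic block model even for \<open>\<beta>\<close> close to \<open>1\<close>; the two adjacent layers allow single flips,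
  whereas swapping two labels would double the signal.
\<close>

definition anchor :: "nat \<Rightarrow> nat \<Rightarrow> nat \<Rightarrow> real" where
  "anchor n k j = (if j < k + 1 + n div 2 then 1 else -1)"

definition hard_labels :: "nat \<Rightarrow> nat \<Rightarrow> (nat \<Rightarrow> real) set" where
  "hard_labels n k = {\<sigma> \<in> labels n. (\<forall>j\<in>{2*k+1..<n}. \<sigma> j = anchor n k j) \<and>
     card {j\<in>{..<2*k+1}. \<sigma> j = 1} \<in> {k, k + 1}}"

text \<open>The fixed labels, being at least two thirds of all, resolve the global sign in the error.\<close>

definition align :: "nat \<Rightarrow> nat \<Rightarrow> (nat \<Rightarrow> real) \<Rightarrow> real" where
  "align n k x =
     (if (\<Sum>j\<in>{2*k+1..<n}. of_bool (x j \<noteq> anchor n k j) :: real)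
       \<le> (\<Sum>j\<in>{2*k+1..<n}. of_bool (- x j \<noteq> anchor n k j)) then 1 else -1)"

text \<open>The sign \<open>align n k x\<close> depends on \<open>x\<close> alone, so the aligned
  labels are still computable from the data. If the minimum in \<open>err\<close> is attained at
  this sign, the free nodes alone give the bound; the opposite sign errs on at least half of the
  fixed nodes, and these are at least twice as many as the free ones.\<close>

lemma err_ge_aligned_errors:
  assumes x: "x \<in> labels n" and \<sigma>: "\<sigma> \<in> hard_labels n k" and n: "6 * k + 3 \<le> n"
  shows "(\<Sum>i<2*k+1. of_bool (align n k x * x i \<noteq> \<sigma> i)) \<le> real n * err n x \<sigma>"
proof -
  define F where "F = {..<2*k+1}"
  define S where "S = {2*k+1..<n}"
  have FS: "{..<n} = F \<union> S" "F \<inter> S = {}" "finite F" "finite S"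
    using n by (auto simp: F_def S_def)
  define H where "H A g = (\<Sum>i\<in>A. of_bool (g * x i \<noteq> \<sigma> i) :: real)" for A g
  have H0: "0 \<le> H A g" for A g by (simp add: H_def sum_nonneg)
  have split: "H {..<n} g = H F g + H S g" for g
    unfolding H_def FS(1) using FS by (intro sum.union_disjoint) auto
  have Sa: "H S g = (\<Sum>j\<in>S. of_bool (g * x j \<noteq> anchor n k j))" for g
    unfolding H_def using \<sigma> by (intro sum.cong) (auto simp: S_def hard_labels_def)
  let ?g = "align n k x"
  have g: "?g = 1 \<or> ?g = -1" by (simp add: align_def)
  have flip: "H S ?g \<le> H S (- ?g)"
  proof -
    have "?g = (if H S 1 \<le> H S (-1) then 1 else -1)"
      unfolding Sa align_def by (simp only: S_def mult_1 mult_minus1)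
    then show ?thesis by (cases "H S 1 \<le> H S (-1)") simp_all
  qed
  have "real (card S) = (\<Sum>i\<in>S. 1)" by simp
  also have "\<dots> \<le> (\<Sum>i\<in>S. of_bool (?g * x i \<noteq> \<sigma> i) + of_bool (- ?g * x i \<noteq> \<sigma> i))"
  proof (rule sum_mono)
    fix i assume "i \<in> S"
    then have "x i = 1 \<or> x i = -1" using labels_cases[OF x] by (auto simp: S_def)
    then show "1 \<le> of_bool (?g * x i \<noteq> \<sigma> i) + (of_bool (- ?g * x i \<noteq> \<sigma> i) :: real)"
      using g by auto
  qed
  also have "\<dots> = H S ?g + H S (- ?g)" by (simp add: H_def sum.distrib)
  finally have "real (card S) \<le> H S ?g + H S (- ?g)" .
  moreover have "real (card S) \<ge> 2 * real (card F)"
    using n by (simp add: S_def F_def)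
  moreover have "H F ?g \<le> real (card F)"
    unfolding H_def by (rule order_trans[OF sum_bounded_above[where K = 1]]) auto
  ultimately have "H F ?g \<le> H {..<n} (- ?g)"
    using flip split[of "- ?g"] H0[of F "- ?g"] by linarith
  moreover have "H F ?g \<le> H {..<n} ?g" using split H0 by simp
  ultimately have le: "H F ?g \<le> H {..<n} g" if "g \<in> {-1, 1}" for g
    using g that by force
  have "n > 0" using n by simp
  have "err n x \<sigma> \<in> (\<lambda>g. 1 / real n * H {..<n} g) ` {-1, 1}"
    unfolding err_def H_def by (intro Min_in) auto
  then obtain g where "g \<in> {-1, 1}" "err n x \<sigma> = 1 / real n * H {..<n} g" by blast
  then show ?thesis using le[of g] \<open>n > 0\<close> by (simp add: H_def F_def)
qed

lemma flip_in_hard_labels: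
  assumes \<sigma>: "\<sigma> \<in> hard_labels n k" and i: "i < 2 * k + 1" and n: "2 * k + 1 \<le> n"
    and c: "if card {j\<in>{..<2*k+1}. \<sigma> j = 1} = k then \<sigma> i = -1 else \<sigma> i = 1"
  shows "\<sigma>(i := - \<sigma> i) \<in> hard_labels n k"
proof -
  let ?\<sigma> = "\<sigma>(i := - \<sigma> i)"
  have "?\<sigma> \<in> labels n"
    using \<sigma> i n by (auto simp: hard_labels_def labels_def PiE_iff extensional_def)
  moreover have "card {j\<in>{..<2*k+1}. ?\<sigma> j = 1} \<in> {k, k + 1}"
  proof (cases "card {j\<in>{..<2*k+1}. \<sigma> j = 1} = k")
    case True
    then have "{j\<in>{..<2*k+1}. ?\<sigma> j = 1} = insert i {j\<in>{..<2*k+1}. \<sigma> j = 1}"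
      "i \<notin> {j\<in>{..<2*k+1}. \<sigma> j = 1}"
      using c i by auto
    then show ?thesis using True by simp
  next
    case False
    then have "card {j\<in>{..<2*k+1}. \<sigma> j = 1} = k + 1" using \<sigma> by (auto simp: hard_labels_def)
    moreover have "{j\<in>{..<2*k+1}. ?\<sigma> j = 1} = {j\<in>{..<2*k+1}. \<sigma> j = 1} - {i}"
      "i \<in> {j\<in>{..<2*k+1}. \<sigma> j = 1}"
      using c i False by auto
    ultimately show ?thesis by (simp only: card_Diff_singleton) simp
  qed
  ultimately show ?thesis using \<sigma> i by (auto simp: hard_labels_def)
qed

text \<open>Because the number \<open>2 * k + 1\<close> of free nodes is odd, both layers offer the
  same number of flips: from \<open>k\<close> ones any of the \<open>k + 1\<close> remaining free
  nodes may be raised, from \<open>k + 1\<close> ones any of these may be lowered.\<close>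

lemma card_flips_ge:
  assumes \<sigma>: "\<sigma> \<in> hard_labels n k" and n: "2 * k + 1 \<le> n"
  shows "k + 1 \<le> card {i\<in>{..<2*k+1}. \<sigma>(i := - \<sigma> i) \<in> hard_labels n k}"
proof -
  define U where "U = {j\<in>{..<2*k+1}. \<sigma> j = 1}"
  define W where "W = (if card U = k then {..<2*k+1} - U else U)"
  have "card ({..<2*k+1} - U) = 2 * k + 1 - card U"
    by (subst card_Diff_subset) (auto simp: U_def)
  then have "card W = k + 1"
    using \<sigma> by (auto simp: W_def hard_labels_def U_def)
  moreover have "W \<subseteq> {i\<in>{..<2*k+1}. \<sigma>(i := - \<sigma> i) \<in> hard_labels n k}"
  proof
    fix i assume i: "i \<in> W"
    then have "i < 2 * k + 1" by (auto simp: W_def U_def split: if_splits)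
    moreover have "if card U = k then \<sigma> i = -1 else \<sigma> i = 1"
      using i labels_cases[of \<sigma> n i] \<sigma> n by (auto simp: W_def U_def hard_labels_def split: if_splits)
    ultimately show "i \<in> {i\<in>{..<2*k+1}. \<sigma>(i := - \<sigma> i) \<in> hard_labels n k}"
      using flip_in_hard_labels[OF \<sigma> _ n, of i] by (auto simp: U_def)
  qed
  ultimately show ?thesis
    using card_mono[of "{i\<in>{..<2*k+1}. \<sigma>(i := - \<sigma> i) \<in> hard_labels n k}" W] by simp
qed

text \<open>\<open>anchor\<close> contributes \<open>n div 2 - k\<close> ones, which complement the
  \<open>k\<close> or \<open>k + 1\<close> free ones.\<close>

lemma card_ones_hard_labels:
  assumes \<sigma>: "\<sigma> \<in> hard_labels n k" and n: "6 * k + 3 \<le> n"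
  shows "card {i\<in>{..<n}. \<sigma> i = 1} \<in> {n div 2, n div 2 + 1}"
proof -
  have "{i\<in>{..<n}. \<sigma> i = 1} = {j\<in>{..<2*k+1}. \<sigma> j = 1} \<union> {2*k+1..<k + 1 + n div 2}"
  proof -
    have "\<sigma> j = 1 \<longleftrightarrow> j < k + 1 + n div 2" if "2 * k + 1 \<le> j" "j < n" for j
      using \<sigma> that by (auto simp: hard_labels_def anchor_def)
    moreover have "k + 1 + n div 2 \<le> n" using n by linarith
    ultimately show ?thesis using n by (auto simp: not_less)
  qed
  moreover have "card ({j\<in>{..<2*k+1}. \<sigma> j = 1} \<union> {2*k+1..<k + 1 + n div 2})
     = card {j\<in>{..<2*k+1}. \<sigma> j = 1} + (n div 2 - k)"
    by (subst card_Un_disjoint) auto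
  \<comment> \<open>This makes the truncated subtraction \<open>n div 2 - k\<close> exact.\<close>
  moreover have "k \<le> n div 2" using n by linarith
  ultimately show ?thesis using \<sigma> by (auto simp: hard_labels_def)
qed

lemma sum_labels:
  assumes "\<sigma> \<in> labels n"
  shows "(\<Sum>i<n. \<sigma> i) = 2 * real (card {i\<in>{..<n}. \<sigma> i = 1}) - real n"
proof -
  have "(\<Sum>i<n. \<sigma> i) = (\<Sum>i<n. 2 * of_bool (\<sigma> i = 1) - 1)"
    using labels_cases[OF assms] by (intro sum.cong) auto
  also have "\<dots> = 2 * real (card {i\<in>{..<n}. \<sigma> i = 1}) - real n"
    by (simp add: sum_subtractf sum_distrib_left[symmetric] of_bool_def sum.If_cases Int_def)
  finally show ?thesis .
qed

lemma hard_labels_nonempty: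
  assumes n: "2 * k + 1 \<le> n"
  shows "hard_labels n k \<noteq> {}"
proof -
  define \<sigma> where "\<sigma> j = (if j < n then if j < k then 1 else if j < 2 * k + 1 then -1 else anchor n k j else undefined)" for j
  have "{j\<in>{..<2*k+1}. \<sigma> j = 1} = {..<k}" using n by (auto simp: \<sigma>_def)
  then have "\<sigma> \<in> hard_labels n k"
    by (auto simp: hard_labels_def \<sigma>_def labels_def PiE_iff anchor_def extensional_def)
  then show ?thesis by blast
qed

lemma hard_labels_subset: "hard_labels n k \<subseteq> labels n"
  by (auto simp: hard_labels_def)

text \<open>Flipping is an involution on the pairs \<open>(\<sigma>, i)\<close> whose flip stays in
  \<open>T\<close>, so the sum of \<open>e\<close> over these pairs is unchanged by it. Adding the
  two versions of this sum collects at least \<open>a\<close> per pair. This bounds the average of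
  \<open>r\<close> under the uniform prior on \<open>T\<close>, and some member reaches the
  average.\<close>

lemma average_over_flips:
  fixes r :: "(nat \<Rightarrow> real) \<Rightarrow> real" and e :: "(nat \<Rightarrow> real) \<Rightarrow> nat \<Rightarrow> real"
  assumes T: "finite T" "T \<noteq> {}"
    and r: "\<And>\<sigma>. \<sigma> \<in> T \<Longrightarrow> (\<Sum>i<m. e \<sigma> i) \<le> c * r \<sigma>" and c: "c > 0"
    and e0: "\<And>\<sigma> i. \<sigma> \<in> T \<Longrightarrow> 0 \<le> e \<sigma> i"
    and e: "\<And>\<sigma> i. \<sigma> \<in> T \<Longrightarrow> i < m \<Longrightarrow> \<sigma>(i := - \<sigma> i) \<in> T \<Longrightarrow> a \<le> e \<sigma> i + e (\<sigma>(i := - \<sigma> i)) i"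
    and l: "\<And>\<sigma>. \<sigma> \<in> T \<Longrightarrow> l \<le> card {i\<in>{..<m}. \<sigma>(i := - \<sigma> i) \<in> T}" and a: "0 \<le> a"
  shows "\<exists>\<sigma>\<in>T. real l * a / (2 * c) \<le> r \<sigma>"
proof (rule ccontr)
  assume neg: "\<not> ?thesis"
  define E where "E = (SIGMA \<sigma>:T. {i\<in>{..<m}. \<sigma>(i := - \<sigma> i) \<in> T})"
  define \<phi> :: "(nat \<Rightarrow> real) \<times> nat \<Rightarrow> (nat \<Rightarrow> real) \<times> nat"
    where "\<phi> = (\<lambda>(\<sigma>, i). (\<sigma>(i := - \<sigma> i), i))"
  have \<phi>: "\<phi> z \<in> E" "\<phi> (\<phi> z) = z" if "z \<in> E" for z
    using that by (auto simp: E_def \<phi>_def)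
  have finE: "finite E" using T by (auto simp: E_def)
  have "real (card T) * (real l * a) = (\<Sum>\<sigma>\<in>T. real l * a)" by simp
  also have "\<dots> \<le> (\<Sum>\<sigma>\<in>T. real (card {i\<in>{..<m}. \<sigma>(i := - \<sigma> i) \<in> T}) * a)"
    using l a by (intro sum_mono mult_right_mono) auto
  also have "\<dots> = (\<Sum>z\<in>E. a)"
    using T by (simp add: E_def card_SigmaI sum_distrib_right)
  also have "\<dots> \<le> (\<Sum>z\<in>E. case_prod e z + case_prod e (\<phi> z))"
    using e by (intro sum_mono) (auto simp: E_def \<phi>_def)
  also have "\<dots> = (\<Sum>z\<in>E. case_prod e z) + (\<Sum>z\<in>E. case_prod e (\<phi> z))"
    by (rule sum.distrib)
  also have "(\<Sum>z\<in>E. case_prod e (\<phi> z)) = (\<Sum>z\<in>E. case_prod e z)"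
    using \<phi> by (intro sum.reindex_bij_witness[of _ \<phi> \<phi>]) auto
  also have "(\<Sum>z\<in>E. case_prod e z) = (\<Sum>\<sigma>\<in>T. \<Sum>i\<in>{i\<in>{..<m}. \<sigma>(i := - \<sigma> i) \<in> T}. e \<sigma> i)"
    unfolding E_def using T by (subst sum.Sigma) auto
  \<comment> \<open>Indices whose flip leaves \<open>T\<close> are added back; their terms are
    nonnegative.\<close>
  also have "\<dots> + \<dots> \<le> 2 * (\<Sum>\<sigma>\<in>T. \<Sum>i<m. e \<sigma> i)"
    using e0 T by (auto intro!: sum_mono sum_mono2)
  also have "\<dots> \<le> 2 * (\<Sum>\<sigma>\<in>T. c * r \<sigma>)"
    using r by (auto intro!: sum_mono)
  also have "\<dots> < 2 * (\<Sum>\<sigma>\<in>T. c * (real l * a / (2 * c)))"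
  proof -
    have lt: "c * r \<sigma> < c * (real l * a / (2 * c))" if "\<sigma> \<in> T" for \<sigma>
      using neg that c by (intro mult_strict_left_mono) (auto simp: not_le)
    show ?thesis by (intro mult_strict_left_mono sum_strict_mono lt T) simp_all
  qed
  also have "\<dots> = real (card T) * (real l * a)"
    using c by simp
  finally show False by simp
qed

subsection \<open>Laws of the observed matrix\<close>

lemma measurable_symmetrize:
  assumes "\<And>e. e \<in> {(i, j). i \<le> j \<and> j < n} \<Longrightarrow> sets (M e) = sets borel"
  shows "symmetrize n \<in> PiM {(i, j). i \<le> j \<and> j < n} M \<rightarrow>\<^sub>M matrix_space n"
  unfolding symmetrize_def matrix_space_def
proof (rule measurable_restrict)
  fix e assume e: "e \<in> {..<n} \<times> {..<n}"
  have comp: "(\<lambda>x. x e') \<in> PiM {(i, j). i \<le> j \<and> j < n} M \<rightarrow>\<^sub>M borel"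
    if "e' \<in> {(i, j). i \<le> j \<and> j < n}" for e'
    using measurable_component_singleton[OF that, of M] assms[OF that]
    by (subst measurable_cong_sets[OF refl, of borel "M e'"]) auto
  show "(\<lambda>x. case e of (i, j) \<Rightarrow> if i \<le> j then x (i, j) else x (j, i))
     \<in> PiM {(i, j). i \<le> j \<and> j < n} M \<rightarrow>\<^sub>M borel"
    using e comp by (cases e; cases "fst e \<le> snd e") auto
qed

lemma finite_upper_triangle: "finite {(i, j). i \<le> j \<and> j < (n::nat)}"
  by (rule finite_subset[of _ "{..<n} \<times> {..<n}"]) auto

text \<open>The entries whose law changes when the label of node \<open>i\<close> is flipped. The
  diagonal entry is left out, as \<open>\<sigma> i * \<sigma> i\<close> is invariant under the
  flip.\<close>

definition star :: "nat \<Rightarrow> nat \<Rightarrow> (nat \<times> nat) set" where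
  "star n i = {(a, b). a < b \<and> b < n \<and> (a = i \<or> b = i)}"

lemma
  assumes "i < n"
  shows card_star: "card (star n i) = n - 1"
    and sum_star: "(\<Sum>(a, b)\<in>star n i. \<sigma> a * \<sigma> b) = (\<sigma> i :: real) * (\<Sum>j\<in>{..<n} - {i}. \<sigma> j)"
proof -
  \<comment> \<open>Sends \<open>j\<close> to the copy of the pair of \<open>i\<close> and
    \<open>j\<close> that lies above the diagonal.\<close>
  define f where "f j = (min i j, max i j)" for j
  have bij: "bij_betw f ({..<n} - {i}) (star n i)"
  proof (rule bij_betw_imageI)
    show "inj_on f ({..<n} - {i})"
      by (auto simp: inj_on_def f_def min_def max_def split: if_splits)
    show "f ` ({..<n} - {i}) = star n i"
    proof
      show "f ` ({..<n} - {i}) \<subseteq> star n i"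
        using assms by (auto simp: f_def star_def min_def max_def split: if_splits)
      show "star n i \<subseteq> f ` ({..<n} - {i})"
      proof
        fix e assume "e \<in> star n i"
        then obtain a b where e: "e = (a, b)" "a < b" "b < n" "a = i \<or> b = i"
          by (auto simp: star_def)
        then have "e = f (if a = i then b else a)" "(if a = i then b else a) \<in> {..<n} - {i}"
          by (auto simp: f_def)
        then show "e \<in> f ` ({..<n} - {i})" by blast
      qed
    qed
  qed
  show "card (star n i) = n - 1"
    using bij_betw_same_card[OF bij] assms by simp
  have "(\<Sum>(a, b)\<in>star n i. \<sigma> a * \<sigma> b) = (\<Sum>j\<in>{..<n} - {i}. \<sigma> (min i j) * \<sigma> (max i j))"
    using sum.reindex_bij_betw[OF bij, of "\<lambda>(a, b). \<sigma> a * \<sigma> b"] by (simp add: f_def)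
  also have "\<dots> = (\<Sum>j\<in>{..<n} - {i}. \<sigma> i * \<sigma> j)"
    by (intro sum.cong) (auto simp: min_def max_def)
  finally show "(\<Sum>(a, b)\<in>star n i. \<sigma> a * \<sigma> b) = (\<sigma> i :: real) * (\<Sum>j\<in>{..<n} - {i}. \<sigma> j)"
    by (simp add: sum_distrib_left)
qed

text \<open>\<open>Q\<close> is the normalised geometric mean of the two entry laws, \<open>\<rho>\<close> their Hellinger affinity, and
  \<open>h\<close> half of their log-likelihood ratio.\<close>

locale tilted_entry =
  fixes D :: "real \<Rightarrow> real measure" and Q :: "real measure" and h :: "real \<Rightarrow> real" and \<rho> v :: real
  assumes D_pos: "D 1 = density Q (\<lambda>x. ennreal (\<rho> * exp (h x)))"
    and D_neg: "D (-1) = density Q (\<lambda>x. ennreal (\<rho> * exp (- h x)))"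
    and prob_D: "prob_space (D 1)" "prob_space (D (-1))"
    and prob_Q: "prob_space Q" and sets_Q: "sets Q = sets borel"
    and h_measurable: "h \<in> borel_measurable borel"
    and h_square: "integrable Q (\<lambda>x. (h x)\<^sup>2)" "(\<integral>x. (h x)\<^sup>2 \<partial>Q) \<le> v"
    and \<rho>_pos: "\<rho> > 0"
begin

lemma prob_D': "s = 1 \<or> s = -1 \<Longrightarrow> prob_space (D s)"
  by (elim disjE) (simp_all only: prob_D)

lemma sets_D: "s = 1 \<or> s = -1 \<Longrightarrow> sets (D s) = sets borel"
  by (elim disjE) (simp_all only: D_pos D_neg sets_density sets_Q)

lemma v_nonneg: "v \<ge> 0"
  using h_square(2) by (rule order_trans[rotated]) simp

lemma symmetrize_law_measurable:
  assumes "\<sigma> \<in> labels n"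
  shows "symmetrize n \<in> PiM {(i, j). i \<le> j \<and> j < n} (\<lambda>(i, j). D (\<sigma> i * \<sigma> j)) \<rightarrow>\<^sub>M matrix_space n"
proof (rule measurable_symmetrize)
  fix e assume "e \<in> {(i, j). i \<le> j \<and> j < n}"
  then obtain i j where "e = (i, j)" "i < n" "j < n" by auto
  then show "sets (case e of (i, j) \<Rightarrow> D (\<sigma> i * \<sigma> j)) = sets borel"
    using sets_D[OF labels_prod[OF assms, of i j]] by simp
qed

text \<open>Product measure results ask for a probability measure at every index, but off the index
  set \<open>\<sigma> i * \<sigma> j\<close> may be no sign at all. The default \<open>D 1\<close>
  there leaves the product measure unchanged.\<close>

lemma PiM_law_extend:
  assumes "\<sigma> \<in> labels n"
  shows "PiM {(i, j). i \<le> j \<and> j < n} (\<lambda>(i, j). D (\<sigma> i * \<sigma> j))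
     = PiM {(i, j). i \<le> j \<and> j < n} (\<lambda>(i, j). if i \<le> j \<and> j < n then D (\<sigma> i * \<sigma> j) else D 1)"
  by (intro PiM_cong) auto

lemma prob_law_extend:
  assumes "\<sigma> \<in> labels n"
  shows "prob_space (case e of (i, j) \<Rightarrow> if i \<le> j \<and> j < n then D (\<sigma> i * \<sigma> j) else D 1)"
proof -
  obtain i j where e: "e = (i, j)" by fastforce
  show ?thesis
    using prob_D prob_D'[OF labels_prod[OF assms, of i j]] by (cases "i \<le> j \<and> j < n") (auto simp: e)
qed

lemma prob_space_matrix_law:
  assumes "\<sigma> \<in> labels n"
  shows "prob_space (matrix_law n D \<sigma>)"
  unfolding matrix_law_def
  by (intro prob_space.prob_space_distr symmetrize_law_measurable[OF assms])
     (unfold PiM_law_extend[OF assms], intro prob_space_PiM prob_law_extend[OF assms])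

lemma space_matrix_law: "space (matrix_law n D \<sigma>) = space (matrix_space n)"
  and sets_matrix_law: "sets (matrix_law n D \<sigma>) = sets (matrix_space n)"
  by (simp_all add: matrix_law_def)

lemma measurable_matrix_law: "measurable (matrix_law n D \<sigma>) N = measurable (matrix_space n) N"
  by (rule measurable_cong_sets) (simp_all add: sets_matrix_law)

text \<open>Pulled back along \<open>symmetrize\<close>, this is a test between two product measures
  on the upper triangle. They differ exactly on \<open>star n i\<close>, where the flip negates
  every sign.\<close>

lemma matrix_law_flip_bound:
  assumes \<sigma>: "\<sigma> \<in> labels n" and i: "i < n" and bal: "\<bar>\<Sum>j<n. \<sigma> j\<bar> \<le> 2"
    and B: "B \<in> sets (matrix_space n)"
  shows "measure (matrix_law n D \<sigma>) B
      + measure (matrix_law n D (\<sigma>(i := - \<sigma> i))) (space (matrix_space n) - B)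
    \<ge> \<rho> ^ (n - 1) * exp (- sqrt ((real n + 9) * v))"
proof -
  let ?I = "{(i, j). i \<le> j \<and> j < n}"
  let ?\<sigma> = "\<sigma>(i := - \<sigma> i)"
  let ?M = "\<lambda>\<sigma>. \<lambda>(i, j). if i \<le> j \<and> j < n then D (\<sigma> i * \<sigma> j) else D 1"
  have \<sigma>': "?\<sigma> \<in> labels n"
    using \<sigma> i by (auto simp: labels_def PiE_iff extensional_def)
  have lab: "\<sigma> j = 1 \<or> \<sigma> j = -1" if "j < n" for j
    using labels_cases[OF \<sigma> that] .
  have sets_law: "sets (case e of (i, j) \<Rightarrow> if i \<le> j \<and> j < n then D (\<tau> i * \<tau> j) else D 1) = sets borel"
    if "\<tau> \<in> labels n" for \<tau> e
  proof -
    obtain i j where e: "e = (i, j)" by fastforce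
    show ?thesis
      using sets_D[of 1] sets_D[OF labels_prod[OF that, of i j]] by (cases "i \<le> j \<and> j < n") (auto simp: e)
  qed
  have sp: "space (PiM ?I (?M \<sigma>)) = space (PiM ?I (?M ?\<sigma>))"
    by (intro sets_eq_imp_space_eq sets_PiM_cong) (simp_all only: sets_law[OF \<sigma>] sets_law[OF \<sigma>'])
  define B' where "B' = symmetrize n -` B \<inter> space (PiM ?I (?M \<sigma>))"
  note sym = symmetrize_law_measurable[OF \<sigma>, unfolded PiM_law_extend[OF \<sigma>]]
  note sym' = symmetrize_law_measurable[OF \<sigma>', unfolded PiM_law_extend[OF \<sigma>']]
  have B': "B' \<in> sets (PiM ?I (?M \<sigma>))"
    unfolding B'_def using sym B by (rule measurable_sets)
  have m1: "measure (matrix_law n D \<sigma>) B = measure (PiM ?I (?M \<sigma>)) B'"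
    unfolding matrix_law_def PiM_law_extend[OF \<sigma>] B'_def by (rule measure_distr[OF sym B])
  have "measure (matrix_law n D ?\<sigma>) (space (matrix_space n) - B)
     = measure (PiM ?I (?M ?\<sigma>)) (symmetrize n -` (space (matrix_space n) - B) \<inter> space (PiM ?I (?M ?\<sigma>)))"
    unfolding matrix_law_def PiM_law_extend[OF \<sigma>'] using B by (intro measure_distr[OF sym']) auto
  also have "symmetrize n -` (space (matrix_space n) - B) \<inter> space (PiM ?I (?M ?\<sigma>))
     = space (PiM ?I (?M ?\<sigma>)) - B'"
    unfolding B'_def sp using measurable_space[OF sym'] by blast
  finally have m2: "measure (matrix_law n D ?\<sigma>) (space (matrix_space n) - B)
     = measure (PiM ?I (?M ?\<sigma>)) (space (PiM ?I (?M ?\<sigma>)) - B')" .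
  define s where "s = (\<lambda>(a, b). \<sigma> a * \<sigma> b)"
  have J: "star n i \<subseteq> ?I" by (auto simp: star_def)
  have s: "s e = 1 \<or> s e = -1" if "e \<in> star n i" for e
  proof -
    obtain a b where "e = (a, b)" "a < b" "b < n" using \<open>e \<in> star n i\<close> by (auto simp: star_def)
    then show ?thesis using labels_prod[OF \<sigma>, of a b] by (simp add: s_def)
  qed
  have "measure (PiM ?I (?M \<sigma>)) B' + measure (PiM ?I (?M ?\<sigma>)) (space (PiM ?I (?M ?\<sigma>)) - B')
     \<ge> \<rho> ^ card (star n i) * exp (- sqrt ((real (card (star n i)) + (\<Sum>e\<in>star n i. s e)\<^sup>2) * v))"
  proof (rule two_point_bound[OF finite_upper_triangle J prob_law_extend[OF \<sigma>] prob_law_extend[OF \<sigma>'] prob_Q _ h_square \<rho>_pos _ _ _ _ B'])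
    show "h \<in> borel_measurable Q"
      using h_measurable by (subst measurable_cong_sets[OF sets_Q refl])
    show "(s e)\<^sup>2 = 1" if "e \<in> star n i" for e
      using s[OF that] by auto
    show "?M ?\<sigma> e = ?M \<sigma> e" if "e \<notin> star n i" for e
      using that by (cases e) (auto simp: star_def)
    show "?M \<sigma> e = density Q (\<lambda>x. ennreal (\<rho> * exp (s e * h x)))" if "e \<in> star n i" for e
    proof -
      have "?M \<sigma> e = D (s e)" using that by (auto simp: star_def s_def)
      then show ?thesis using s[OF that] by (auto simp: D_pos D_neg)
    qed
    show "?M ?\<sigma> e = density Q (\<lambda>x. ennreal (\<rho> * exp (- s e * h x)))" if "e \<in> star n i" for e
    proof -
      have "?M ?\<sigma> e = D (- s e)" using that by (auto simp: star_def s_def)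
      then show ?thesis using s[OF that] by (auto simp: D_pos D_neg)
    qed
  qed
  \<comment> \<open>Up to sign the sum is the total of all labels, at most \<open>2\<close> in
    absolute value, minus one label. Hence \<open>3\<close>, and the summand \<open>9\<close> in the
    bound.\<close>
  moreover have "(\<Sum>e\<in>star n i. s e)\<^sup>2 \<le> 9"
  proof -
    have "(\<Sum>e\<in>star n i. s e) = \<sigma> i * ((\<Sum>j<n. \<sigma> j) - \<sigma> i)"
      using sum_star[OF i, of \<sigma>] i by (simp add: s_def sum_diff1)
    then have "\<bar>\<Sum>e\<in>star n i. s e\<bar> \<le> 3"
      using lab[OF i] bal by auto
    then have "\<bar>\<Sum>e\<in>star n i. s e\<bar>\<^sup>2 \<le> 3\<^sup>2" by (intro power_mono) auto
    then show ?thesis by simp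
  qed
  then have "(real (card (star n i)) + (\<Sum>e\<in>star n i. s e)\<^sup>2) * v \<le> (real n + 9) * v"
    using v_nonneg unfolding card_star[OF i] by (intro mult_right_mono add_mono) simp_all
  then have "\<rho> ^ (n - 1) * exp (- sqrt ((real n + 9) * v))
      \<le> \<rho> ^ card (star n i) * exp (- sqrt ((real (card (star n i)) + (\<Sum>e\<in>star n i. s e)\<^sup>2) * v))"
    using \<rho>_pos unfolding card_star[OF i] by (intro mult_left_mono) simp_all
  ultimately show ?thesis unfolding m1 m2 by linarith
qed

lemma minimax_risk_ge:
  assumes n: "3 \<le> n" and \<Theta>: "\<Theta> \<subseteq> labels n" "hard_labels n ((n - 3) div 6) \<subseteq> \<Theta>"
  shows "minimax_risk n D \<Theta> \<ge> 1 / 36 * (\<rho> ^ (n - 1) * exp (- sqrt ((real n + 9) * v)))"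
proof -
  \<comment> \<open>The largest \<open>k\<close> with \<open>6 * k + 3 \<le> n\<close>: two thirds
    of the nodes are fixed, yet a constant fraction stays free.\<close>
  define k where "k = (n - 3) div 6"
  have k: "6 * k + 3 \<le> n" "n \<le> 6 * k + 8" using n by (auto simp: k_def)
  then have n0: "n > 0" and kn: "2 * k + 1 \<le> n" by linarith+
  define T where "T = hard_labels n k"
  have T: "finite T" "T \<noteq> {}" "T \<subseteq> \<Theta>" "T \<subseteq> labels n"
    using hard_labels_nonempty[OF kn] hard_labels_subset finite_subset[OF _ finite_labels]
    \<Theta> unfolding T_def k_def by blast+
  define a where "a = \<rho> ^ (n - 1) * exp (- sqrt ((real n + 9) * v))"
  have a0: "a \<ge> 0" using \<rho>_pos by (simp add: a_def)
  have bal: "\<bar>\<Sum>j<n. \<sigma> j\<bar> \<le> 2" if "\<sigma> \<in> T" for \<sigma>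
  proof -
    have "real (card {i\<in>{..<n}. \<sigma> i = 1}) \<in> {real (n div 2), real (n div 2) + 1}"
      using card_ones_hard_labels[of \<sigma> n k] that k by (auto simp: T_def)
    moreover have "2 * real (n div 2) \<le> real n" "real n \<le> 2 * real (n div 2) + 1" by linarith+
    ultimately show ?thesis using sum_labels[of \<sigma> n] that T by auto
  qed
  have "a / 36 \<le> (SUP \<sigma>\<in>\<Theta>. \<integral>A. err n (est A) \<sigma> \<partial>matrix_law n D \<sigma>)" if est: "est \<in> estimators n" for est
  proof -
    have est_meas: "est \<in> matrix_space n \<rightarrow>\<^sub>M count_space (labels n)"
      using est by (simp add: estimators_def)
    have est_lab: "est A \<in> labels n" if "A \<in> space (matrix_space n)" for A
      using measurable_space[OF est_meas that] by simp
    \<comment> \<open>The event that the aligned estimate errs at node \<open>i\<close>; it depends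
      on \<open>\<sigma>\<close> only through \<open>\<sigma> i\<close>.\<close>
    define B where "B \<sigma> i = {A \<in> space (matrix_space n). align n k (est A) * est A i \<noteq> \<sigma> i}" for \<sigma> i
    have B: "B \<sigma> i \<in> sets (matrix_space n)" for \<sigma> i
    proof -
      have "B \<sigma> i = est -` {x \<in> labels n. align n k x * x i \<noteq> \<sigma> i} \<inter> space (matrix_space n)"
        using est_lab by (auto simp: B_def)
      moreover have "\<dots> \<in> sets (matrix_space n)" by (rule measurable_sets[OF est_meas]) auto
      ultimately show ?thesis by simp
    qed
    define r where "r \<sigma> = (\<integral>A. err n (est A) \<sigma> \<partial>matrix_law n D \<sigma>)" for \<sigma>
    define e where "e \<sigma> i = measure (matrix_law n D \<sigma>) (B \<sigma> i)" for \<sigma> i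
    have "\<exists>\<sigma>\<in>T. real (k + 1) * a / (2 * real n) \<le> r \<sigma>"
    proof (rule average_over_flips[where T = T and m = "2 * k + 1" and e = e])
      fix \<sigma> assume \<sigma>T: "\<sigma> \<in> T"
      then have \<sigma>: "\<sigma> \<in> labels n" using T by blast
      interpret prob_space "matrix_law n D \<sigma>" by (rule prob_space_matrix_law[OF \<sigma>])
      have "(\<lambda>A. err n (est A) \<sigma>) \<in> borel_measurable (matrix_space n)"
        by (rule measurable_compose[OF est_meas]) simp
      then have int: "integrable (matrix_law n D \<sigma>) (\<lambda>A. err n (est A) \<sigma>)"
        using err_bounds[OF n0] by (intro integrable_const_bound[where B = 1]) (auto simp: measurable_matrix_law)
      have intB: "integrable (matrix_law n D \<sigma>) (\<lambda>A. indicator (B \<sigma> i) A :: real)" for i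
        using B by (intro integrable_real_indicator) (auto simp: sets_matrix_law emeasure_eq_measure)
      have "(\<Sum>i<2*k+1. e \<sigma> i) = (\<integral>A. (\<Sum>i<2*k+1. indicator (B \<sigma> i) A) \<partial>matrix_law n D \<sigma>)"
        unfolding e_def using intB B sets.sets_into_space[OF B]
        by (simp add: Bochner_Integration.integral_sum sets_matrix_law space_matrix_law Int_absorb2 Int_absorb1)
      also have "\<dots> \<le> (\<integral>A. real n * err n (est A) \<sigma> \<partial>matrix_law n D \<sigma>)"
      proof (rule integral_mono)
        fix A assume "A \<in> space (matrix_law n D \<sigma>)"
        then have A: "A \<in> space (matrix_space n)" by (simp add: space_matrix_law)
        then have "(\<Sum>i<2*k+1. indicator (B \<sigma> i) A)
            = (\<Sum>i<2*k+1. of_bool (align n k (est A) * est A i \<noteq> \<sigma> i) :: real)"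
          by (intro sum.cong) (auto simp: B_def indicator_def)
        also have "\<dots> \<le> real n * err n (est A) \<sigma>"
          using \<sigma>T k by (intro err_ge_aligned_errors est_lab[OF A]) (auto simp: T_def)
        finally show "(\<Sum>i<2*k+1. indicator (B \<sigma> i) A) \<le> real n * err n (est A) \<sigma>" .
      qed (use int intB in auto)
      also have "\<dots> = real n * r \<sigma>" by (simp add: r_def)
      finally show "(\<Sum>i<2*k+1. e \<sigma> i) \<le> real n * r \<sigma>" .
      show "0 \<le> e \<sigma> i" for i by (simp add: e_def)
      show "k + 1 \<le> card {i \<in> {..<2 * k + 1}. \<sigma>(i := - \<sigma> i) \<in> T}"
        using card_flips_ge[OF _ kn, of \<sigma>] \<sigma>T by (simp add: T_def)
      fix i assume i: "i < 2 * k + 1"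
      then have i_n: "i < n" using kn by simp
      \<comment> \<open>The aligned estimate at \<open>i\<close> is \<open>1\<close> or
        \<open>-1\<close>, so it errs against exactly one of \<open>\<sigma>\<close> and its flip.
        The two error events are therefore complementary, as in a test.\<close>
      have "space (matrix_space n) - B \<sigma> i = B (\<sigma>(i := - \<sigma> i)) i"
      proof -
        have "align n k (est A) * est A i = 1 \<or> align n k (est A) * est A i = -1"
          if "A \<in> space (matrix_space n)" for A
          using labels_cases[OF est_lab[OF that] i_n] by (auto simp: align_def)
        moreover have "\<sigma> i = 1 \<or> \<sigma> i = -1" using labels_cases[OF \<sigma> i_n] .
        ultimately show ?thesis by (fastforce simp: B_def)
      qed
      then show "a \<le> e \<sigma> i + e (\<sigma>(i := - \<sigma> i)) i"
        using matrix_law_flip_bound[OF \<sigma> i_n bal[OF \<sigma>T] B[of \<sigma> i]] by (simp add: a_def e_def)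
    qed (use T n0 a0 in auto)
    then obtain \<sigma> where \<sigma>: "\<sigma> \<in> T" "real (k + 1) * a / (2 * real n) \<le> r \<sigma>" by blast
    \<comment> \<open>Follows with room to spare from \<open>n \<le> 6 * k + 8\<close>; any positive
      constant would serve the asymptotics.\<close>
    have "1 / 36 \<le> real (k + 1) / (2 * real n)"
      using k n0 by (simp add: field_simps)
    from mult_right_mono[OF this a0] have "a / 36 \<le> real (k + 1) * a / (2 * real n)"
      by simp
    also have "\<dots> \<le> r \<sigma>" by fact
    also have "\<dots> \<le> (SUP \<sigma>\<in>\<Theta>. r \<sigma>)"
      using \<sigma> T finite_subset[OF \<Theta>(1) finite_labels] by (intro cSUP_upper bdd_above_finite) auto
    finally show ?thesis by (simp add: r_def)
  qed
  \<comment> \<open>A lower bound on a real-valued infimum requires a nonempty index set.\<close>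
  moreover have "estimators n \<noteq> {}"
  proof -
    obtain \<sigma> where "\<sigma> \<in> labels n" using T by blast
    then have "(\<lambda>_. \<sigma>) \<in> estimators n" by (simp add: estimators_def)
    then show ?thesis by blast
  qed
  ultimately have "a / 36 \<le> minimax_risk n D \<Theta>"
    unfolding minimax_risk_def by (intro cINF_greatest)
  then show ?thesis by (simp add: a_def)
qed

end

subsection \<open>The three models\<close>

text \<open>The ratio of the two mass functions is a function \<open>c\<close> of the observed value
  \<open>f x\<close>, so it survives the push-forward to the reals as a density.\<close>

lemma distr_pmf_density:
  fixes f :: "'a \<Rightarrow> real"
  assumes eq: "\<And>x. pmf P x = c (f x) * pmf R x" and c: "\<And>y. 0 \<le> c y" "c \<in> borel_measurable borel"
  shows "distr P borel f = density (distr R borel f) (\<lambda>y. ennreal (c y))"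
proof -
  have "measure_pmf P = density (measure_pmf R) (\<lambda>x. ennreal (c (f x)))"
    unfolding measure_pmf_eq_density
    by (subst density_density_eq) (auto simp: eq c ennreal_mult'[symmetric] mult.commute)
  then have "distr P borel f = distr (density (measure_pmf R) (\<lambda>x. ennreal (c (f x)))) borel f"
    by simp
  also have "\<dots> = density (distr R borel f) (\<lambda>y. ennreal (c y))"
    using c by (intro density_distr[symmetric]) auto
  finally show ?thesis .
qed

text \<open>Tilting the geometric mean by half the log-ratio, in either direction, recovers the two
  weights. This produces the densities in the discrete models.\<close>

lemma sqrt_mult_exp_half_ln:
  assumes "a > 0" "b > 0"
  shows "sqrt (a * b) * exp (ln (a / b) / 2) = a" "sqrt (a * b) * exp (- (ln (a / b) / 2)) = b"
proof -
  have E: "exp (ln (a / b) / 2) = sqrt a / sqrt b"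
    using assms by (simp add: ln_sqrt[symmetric] real_sqrt_divide)
  have E': "exp (- (ln (a / b) / 2)) = sqrt b / sqrt a"
    by (simp add: exp_minus E)
  show "sqrt (a * b) * exp (ln (a / b) / 2) = a" "sqrt (a * b) * exp (- (ln (a / b) / 2)) = b"
    unfolding E E' using assms by (simp_all add: real_sqrt_mult)
qed

text \<open>Writing \<open>sqrt a = g * exp z\<close> and \<open>sqrt b = g * exp (- z)\<close>
  reduces the claim to \<open>\<bar>z\<bar> \<le> \<bar>sinh z\<bar>\<close>. It bounds the second
  moment of \<open>h\<close> by a squared Hellinger distance with no control on the ratio
  \<open>a / b\<close>.\<close>

lemma sqrt_mult_half_ln_square_le:
  assumes "a > 0" "b > 0"
  shows "sqrt (a * b) * (ln (a / b) / 2)\<^sup>2 \<le> (sqrt a - sqrt b)\<^sup>2"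
proof -
  define z where "z = ln (a / b) / 4"
  define g where "g = sqrt (sqrt (a * b))"
  have g2: "g\<^sup>2 = sqrt (a * b)" using assms by (simp add: g_def)
  have g0: "g > 0" using assms by (simp add: g_def)
  have z2: "exp z * exp z = exp (ln (a / b) / 2)" "exp (-z) * exp (-z) = exp (- (ln (a / b) / 2))"
    by (simp_all add: z_def mult_exp_exp)
  have "(g * exp z)\<^sup>2 = a" "(g * exp (- z))\<^sup>2 = b"
    using sqrt_mult_exp_half_ln[OF assms] by (simp_all add: power_mult_distrib g2 power2_eq_square[of "exp _"] z2)
  then have s: "sqrt a = g * exp z" "sqrt b = g * exp (- z)"
    using g0 by (auto intro!: real_sqrt_unique)
  have "\<bar>2 * z\<bar> \<le> \<bar>exp z - exp (- z)\<bar>"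
    using real_le_abs_sinh[of z] by (simp add: exp_minus abs_mult)
  then have "(2 * z)\<^sup>2 \<le> (exp z - exp (- z))\<^sup>2"
    by (simp only: abs_le_square_iff)
  then have "g\<^sup>2 * (2 * z)\<^sup>2 \<le> g\<^sup>2 * (exp z - exp (- z))\<^sup>2"
    by (intro mult_left_mono) auto
  also have "\<dots> = (sqrt a - sqrt b)\<^sup>2"
    by (simp add: s power_mult_distrib[symmetric] right_diff_distrib)
  finally show ?thesis by (simp add: g2 z_def)
qed

text \<open>Expanding the square in the Gaussian density with mean \<open>s\<close> leaves the
  centred Gaussian, the constant \<open>exp (- z2_snr \<tau>)\<close> and a linear tilt. The second
  moment of \<open>h\<close> is then the variance divided by the fourth power of
  \<open>\<tau>\<close>.\<close>

lemma tilted_entry_z2: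
  assumes \<tau>: "\<tau> > 0"
  shows "tilted_entry (z2_entry \<tau>) (density lborel (normal_density 0 \<tau>)) (\<lambda>x. x / \<tau>\<^sup>2)
     (exp (- z2_snr \<tau>)) (2 * z2_snr \<tau>)"
proof (rule tilted_entry.intro)
  have e: "exp (- (x - s)\<^sup>2 / (2 * \<tau>\<^sup>2))
      = exp (- x\<^sup>2 / (2 * \<tau>\<^sup>2)) * (exp (- z2_snr \<tau>) * exp (s * (x / \<tau>\<^sup>2)))" if "s\<^sup>2 = 1" for s x :: real
  proof -
    have "- (x - s)\<^sup>2 / (2 * \<tau>\<^sup>2) = - x\<^sup>2 / (2 * \<tau>\<^sup>2) + (- z2_snr \<tau> + s * (x / \<tau>\<^sup>2))"
      using \<tau> that by (simp add: z2_snr_def power2_diff field_simps)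
    then show ?thesis by (simp only: exp_add)
  qed
  have d: "z2_entry \<tau> s = density (density lborel (normal_density 0 \<tau>))
      (\<lambda>x. ennreal (exp (- z2_snr \<tau>) * exp (s * (x / \<tau>\<^sup>2))))" if "s\<^sup>2 = 1" for s :: real
    unfolding z2_entry_def using e[OF that]
    by (subst density_density_eq) (auto simp: ennreal_mult'[symmetric] normal_density_def)
  show "z2_entry \<tau> 1 = density (density lborel (normal_density 0 \<tau>))
      (\<lambda>x. ennreal (exp (- z2_snr \<tau>) * exp (x / \<tau>\<^sup>2)))"
    using d[of 1] by simp
  show "z2_entry \<tau> (-1) = density (density lborel (normal_density 0 \<tau>))
      (\<lambda>x. ennreal (exp (- z2_snr \<tau>) * exp (- (x / \<tau>\<^sup>2))))"
    using d[of "-1"] by simp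
  show "prob_space (z2_entry \<tau> 1)" "prob_space (z2_entry \<tau> (-1))"
      "prob_space (density lborel (normal_density 0 \<tau>))"
    using \<tau> by (simp_all add: z2_entry_def prob_space_normal_density)
  have m: "has_bochner_integral lborel (\<lambda>x. normal_density 0 \<tau> x * x\<^sup>2) (\<tau>\<^sup>2)"
    using normal_moment_even[of \<tau> 0 1] \<tau> by (simp add: fact_numeral)
  have sq: "normal_density 0 \<tau> x * (x / \<tau>\<^sup>2)\<^sup>2 = normal_density 0 \<tau> x * x\<^sup>2 / (\<tau>\<^sup>2)\<^sup>2" for x
    by (simp add: power_divide)
  show "integrable (density lborel (normal_density 0 \<tau>)) (\<lambda>x. (x / \<tau>\<^sup>2)\<^sup>2)"
    using m by (subst integrable_density) (auto simp: sq has_bochner_integral_iff)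
  have "(\<integral>x. (x / \<tau>\<^sup>2)\<^sup>2 \<partial>density lborel (normal_density 0 \<tau>)) = \<tau>\<^sup>2 / (\<tau>\<^sup>2)\<^sup>2"
    using m by (subst integral_density) (auto simp: sq has_bochner_integral_iff)
  then show "(\<integral>x. (x / \<tau>\<^sup>2)\<^sup>2 \<partial>density lborel (normal_density 0 \<tau>)) \<le> 2 * z2_snr \<tau>"
    using \<tau> by (simp add: z2_snr_def field_simps power2_eq_square)
qed auto

lemma prob_space_distr_pmf: "prob_space (distr (measure_pmf P) borel (f :: 'a \<Rightarrow> real))"
  by (rule prob_space.prob_space_distr) (auto intro: measure_pmf.prob_space_axioms)

text \<open>The weights \<open>sqrt (p * q)\<close> and \<open>sqrt ((1 - p) * (1 - q))\<close> sum
  to \<open>\<rho>\<close> and are normalised to a Bernoulli law. The second moment of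
  \<open>h\<close> is at most the squared Hellinger distance \<open>2 - 2 * \<rho>\<close> over
  \<open>\<rho>\<close>, and \<open>ln \<rho> \<le> \<rho> - 1\<close> turns this into the
  signal-to-noise ratio. The bound \<open>1 - p \<le> \<rho>\<close> will keep the divisor away from
  zero.\<close>

lemma tilted_entry_sbm:
  assumes q: "0 < q" and p: "p < 1" and qp: "q < p"
  defines "\<rho> \<equiv> sqrt (p * q) + sqrt ((1 - p) * (1 - q))"
  shows "tilted_entry (sbm_entry p q) (distr (bernoulli_pmf (sqrt (p * q) / \<rho>)) borel of_bool)
    (\<lambda>x. if x = 1 then ln (p / q) / 2 else ln ((1 - p) / (1 - q)) / 2) \<rho> (sbm_snr p q / \<rho>)"
    (is "tilted_entry _ ?Q ?h _ _")
    and "0 \<le> sbm_snr p q" and "\<rho> = exp (- (sbm_snr p q / 2))" and "1 - p \<le> \<rho>"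
proof -
  let ?r = "sqrt (p * q) / \<rho>"
  have pos: "p > 0" "1 - p > 0" "1 - q > 0" "q > 0" using assms by linarith+
  have s: "sqrt (p * q) > 0" "sqrt ((1 - p) * (1 - q)) > 0" using pos by auto
  have \<rho>0: "\<rho> > 0" unfolding \<rho>_def using s by (rule add_pos_pos)
  have r: "0 \<le> ?r" "?r \<le> 1" and r1: "1 - ?r = sqrt ((1 - p) * (1 - q)) / \<rho>"
    using s \<rho>0 by (auto simp: \<rho>_def field_simps)
  \<comment> \<open>The squared Hellinger distance of the two Bernoulli laws; its nonnegativity
    gives \<open>\<rho> \<le> 1\<close>.\<close>
  have two: "2 - 2 * \<rho> = (sqrt p - sqrt q)\<^sup>2 + (sqrt (1 - p) - sqrt (1 - q))\<^sup>2"
    using pos by (simp add: \<rho>_def power2_diff real_sqrt_mult)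
  then have "\<rho> \<le> 1" by (smt (verit) zero_le_power2)
  then show snr0: "0 \<le> sbm_snr p q"
    using \<rho>0 by (simp add: sbm_snr_def \<rho>_def[symmetric])
  show "\<rho> = exp (- (sbm_snr p q / 2))"
    using \<rho>0 by (simp add: sbm_snr_def \<rho>_def[symmetric])
  have "1 - p = sqrt ((1 - p) * (1 - p))" using pos by simp
  also have "\<dots> \<le> sqrt ((1 - p) * (1 - q))"
    using pos qp by (intro real_sqrt_le_mono mult_left_mono) auto
  finally show "1 - p \<le> \<rho>" unfolding \<rho>_def using s(1) by linarith
  have snr: "2 - 2 * \<rho> \<le> sbm_snr p q"
    using ln_le_minus_one[OF \<rho>0] by (simp add: sbm_snr_def \<rho>_def[symmetric])
  have h: "?h \<in> borel_measurable borel" by measurable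
  note e = sqrt_mult_exp_half_ln[OF pos(1,4)] sqrt_mult_exp_half_ln[OF pos(2,3)]
  show "tilted_entry (sbm_entry p q) ?Q ?h \<rho> (sbm_snr p q / \<rho>)"
  proof (rule tilted_entry.intro)
    show "sbm_entry p q 1 = density ?Q (\<lambda>x. ennreal (\<rho> * exp (?h x)))"
      unfolding sbm_entry_def
    proof (rule distr_pmf_density)
      show "pmf (bernoulli_pmf (if 1 = (1::real) then p else q)) b
          = \<rho> * exp (?h (of_bool b)) * pmf (bernoulli_pmf ?r) b" for b
        using pos r r1 e \<rho>0 by (cases b) (simp_all add: mult.commute)
    qed (use \<rho>0 h in auto)
    show "sbm_entry p q (-1) = density ?Q (\<lambda>x. ennreal (\<rho> * exp (- ?h x)))"
      unfolding sbm_entry_def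
    proof (rule distr_pmf_density)
      show "pmf (bernoulli_pmf (if - 1 = (1::real) then p else q)) b
          = \<rho> * exp (- ?h (of_bool b)) * pmf (bernoulli_pmf ?r) b" for b
        using pos r r1 e \<rho>0 by (cases b) (simp_all add: mult.commute)
    qed (use \<rho>0 h in auto)
    show "integrable ?Q (\<lambda>x. (?h x)\<^sup>2)"
      using h by (subst integrable_distr_eq) (auto intro!: integrable_measure_pmf_finite)
    have "(\<integral>x. (?h x)\<^sup>2 \<partial>?Q) = (\<integral>b. (?h (of_bool b))\<^sup>2 \<partial>bernoulli_pmf ?r)"
      using h by (subst integral_distr) auto
    also have "\<dots> = (ln (p / q) / 2)\<^sup>2 * ?r + (ln ((1 - p) / (1 - q)) / 2)\<^sup>2 * (1 - ?r)"
      using r by (subst integral_bernoulli_pmf) auto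
    also have "\<dots> = (sqrt (p * q) * (ln (p / q) / 2)\<^sup>2
        + sqrt ((1 - p) * (1 - q)) * (ln ((1 - p) / (1 - q)) / 2)\<^sup>2) / \<rho>"
      unfolding r1 by (simp add: add_divide_distrib mult.commute)
    also have "\<dots> \<le> (2 - 2 * \<rho>) / \<rho>"
      unfolding two using pos \<rho>0 by (intro divide_right_mono add_mono sqrt_mult_half_ln_square_le) auto
    also have "\<dots> \<le> sbm_snr p q / \<rho>"
      using snr \<rho>0 by (intro divide_right_mono) auto
    finally show "(\<integral>x. (?h x)\<^sup>2 \<partial>?Q) \<le> sbm_snr p q / \<rho>" .
  qed (use \<rho>0 h in \<open>auto simp: sbm_entry_def intro!: prob_space_distr_pmf\<close>)
qed

text \<open>The value \<open>0\<close> has weight \<open>1 - \<alpha>\<close> under both signs and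
  so is not tilted, in accordance with \<open>h\<close> vanishing there. The values \<open>1\<close>
  and \<open>-1\<close> both have the geometric mean
  \<open>\<alpha> * sqrt (\<epsilon> * (1 - \<epsilon>))\<close>; the three weights sum to
  \<open>1 - cbm_snr \<alpha> \<epsilon>\<close>.\<close>

lemma tilted_entry_cbm:
  assumes \<alpha>: "0 < \<alpha>" "\<alpha> \<le> 1" and \<epsilon>: "0 < \<epsilon>" "\<epsilon> < 1 / 2"
  defines "\<rho> \<equiv> 1 - cbm_snr \<alpha> \<epsilon>"
  assumes \<rho>0: "\<rho> > 0"
  defines "w \<equiv> \<alpha> * sqrt (\<epsilon> * (1 - \<epsilon>)) / \<rho>"
  shows "tilted_entry (cbm_entry \<alpha> \<epsilon>)
    (distr (pmf_of_list [(1, w), (-1, w), (0, 1 - 2 * w)]) borel (\<lambda>x. x))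
    (\<lambda>x. x * (ln ((1 - \<epsilon>) / \<epsilon>) / 2)) \<rho> (2 * cbm_snr \<alpha> \<epsilon> / \<rho>)"
    (is "tilted_entry _ ?Q ?h _ _")
proof -
  let ?g = "sqrt ((1 - \<epsilon>) * \<epsilon>)"
  let ?t = "ln ((1 - \<epsilon>) / \<epsilon>) / 2"
  have g0: "?g \<ge> 0" using \<epsilon> by simp
  have snr: "cbm_snr \<alpha> \<epsilon> = \<alpha> * (sqrt (1 - \<epsilon>) - sqrt \<epsilon>)\<^sup>2"
    using \<alpha> by (simp add: cbm_snr_def real_sqrt_mult power_mult_distrib right_diff_distrib[symmetric])
  also have "(sqrt (1 - \<epsilon>) - sqrt \<epsilon>)\<^sup>2 = 1 - 2 * ?g"
    using \<epsilon> by (simp add: power2_diff real_sqrt_mult)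
  finally have \<rho>: "\<rho> = (1 - \<alpha>) + 2 * \<alpha> * ?g" by (simp add: \<rho>_def algebra_simps)
  have w: "\<rho> * w = \<alpha> * ?g" using \<rho>0 by (simp add: w_def mult.commute)
  have w0: "w \<ge> 0" using \<alpha> g0 \<rho>0 by (simp add: w_def mult.commute)
  have w1: "\<rho> * (1 - 2 * w) = 1 - \<alpha>" using w \<rho> by (simp add: right_diff_distrib)
  then have "0 \<le> \<rho> * (1 - 2 * w)" using \<alpha> by simp
  then have w2: "1 - 2 * w \<ge> 0" using \<rho>0 by (simp add: zero_le_mult_iff)
  have wfQ: "pmf_of_list_wf [(1::real, w), (-1, w), (0, 1 - 2 * w)]"
    using w0 w2 by (intro pmf_of_list_wfI) auto
  have wfD: "pmf_of_list_wf [(s, \<alpha> * (1 - \<epsilon>)), (- s, \<alpha> * \<epsilon>), (0, 1 - \<alpha>)]" for s :: real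
  proof (rule pmf_of_list_wfI)
    show "sum_list (map snd [(s, \<alpha> * (1 - \<epsilon>)), (- s, \<alpha> * \<epsilon>), (0, 1 - \<alpha>)]) = 1"
      by (simp add: algebra_simps)
  qed (use \<alpha> \<epsilon> in auto)
  have e: "\<rho> * exp ?t * w = \<alpha> * (1 - \<epsilon>)" "\<rho> * exp (- ?t) * w = \<alpha> * \<epsilon>"
  proof -
    have "\<rho> * exp ?t * w = (\<rho> * w) * exp ?t" "\<rho> * exp (- ?t) * w = (\<rho> * w) * exp (- ?t)" by simp_all
    then show "\<rho> * exp ?t * w = \<alpha> * (1 - \<epsilon>)" "\<rho> * exp (- ?t) * w = \<alpha> * \<epsilon>"
      using sqrt_mult_exp_half_ln[of "1 - \<epsilon>" \<epsilon>] \<epsilon> unfolding w by (simp_all only: mult.assoc)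
  qed
  have h: "?h \<in> borel_measurable borel" by measurable
  let ?R = "pmf_of_list [(1::real, w), (-1, w), (0, 1 - 2 * w)]"
  have set: "set_pmf ?R \<subseteq> {1, -1, 0}" using set_pmf_of_list[OF wfQ] by auto
  show ?thesis
  proof (rule tilted_entry.intro)
    show "cbm_entry \<alpha> \<epsilon> 1 = density ?Q (\<lambda>x. ennreal (\<rho> * exp (?h x)))"
      unfolding cbm_entry_def
    proof (rule distr_pmf_density)
      show "pmf (pmf_of_list [(1, \<alpha> * (1 - \<epsilon>)), (- 1, \<alpha> * \<epsilon>), (0, 1 - \<alpha>)]) x
          = \<rho> * exp (?h x) * pmf ?R x" for x
        by (subst pmf_pmf_of_list[OF wfD], subst pmf_pmf_of_list[OF wfQ]) (use e w1 in auto)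
    qed (use \<rho>0 h in auto)
    show "cbm_entry \<alpha> \<epsilon> (-1) = density ?Q (\<lambda>x. ennreal (\<rho> * exp (- ?h x)))"
      unfolding cbm_entry_def
    proof (rule distr_pmf_density)
      show "pmf (pmf_of_list [(- 1, \<alpha> * (1 - \<epsilon>)), (- (- 1), \<alpha> * \<epsilon>), (0, 1 - \<alpha>)]) x
          = \<rho> * exp (- ?h x) * pmf ?R x" for x
        by (subst pmf_pmf_of_list[OF wfD], subst pmf_pmf_of_list[OF wfQ]) (use e w1 in auto)
    qed (use \<rho>0 h in auto)
    show "integrable ?Q (\<lambda>x. (?h x)\<^sup>2)"
      using h finite_subset[OF set] by (subst integrable_distr_eq) (auto intro!: integrable_measure_pmf_finite)
    have "(\<integral>x. (?h x)\<^sup>2 \<partial>?Q) = (\<integral>x. (?h x)\<^sup>2 \<partial>?R)"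
      using h by (subst integral_distr) auto
    also have "\<dots> = (\<Sum>x\<in>{1, -1, 0}. (?h x)\<^sup>2 * pmf ?R x)"
      using set by (intro integral_measure_pmf_real) auto
    also have "\<dots> = 2 * (w * ?t\<^sup>2)"
      by (simp add: pmf_pmf_of_list[OF wfQ])
    also have "\<dots> = 2 * (\<rho> * w * ?t\<^sup>2) / \<rho>" using \<rho>0 by simp
    also have "\<dots> = 2 * (\<alpha> * (?g * ?t\<^sup>2)) / \<rho>" unfolding w by simp
    also have "\<dots> \<le> 2 * (\<alpha> * (sqrt (1 - \<epsilon>) - sqrt \<epsilon>)\<^sup>2) / \<rho>"
      using \<alpha> \<epsilon> \<rho>0 by (intro divide_right_mono mult_left_mono sqrt_mult_half_ln_square_le) auto
    finally show "(\<integral>x. (?h x)\<^sup>2 \<partial>?Q) \<le> 2 * cbm_snr \<alpha> \<epsilon> / \<rho>" by (simp add: snr)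
  qed (use \<rho>0 h in \<open>auto simp: cbm_entry_def intro!: prob_space_distr_pmf\<close>)
qed

section \<open>Admissibility of the class in the block model, and passage to the limit\<close>

lemma hard_labels_subset_sbm_labels:
  assumes n: "3 \<le> n" and \<beta>: "\<beta> > 1 + 4 / real n"
  shows "hard_labels n ((n - 3) div 6) \<subseteq> sbm_labels n \<beta>"
proof
  fix \<sigma> assume \<sigma>: "\<sigma> \<in> hard_labels n ((n - 3) div 6)"
  let ?c = "real (card {i\<in>{..<n}. \<sigma> i = 1})"
  have "card {i\<in>{..<n}. \<sigma> i = 1} \<in> {n div 2, n div 2 + 1}"
    using \<sigma> n by (intro card_ones_hard_labels) auto
  then have "n \<le> 2 * card {i\<in>{..<n}. \<sigma> i = 1} + 1" "2 * card {i\<in>{..<n}. \<sigma> i = 1} \<le> n + 2"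
    by auto
  then have c: "real n - 1 \<le> 2 * ?c" "2 * ?c \<le> real n + 2" by linarith+
  have \<beta>0: "\<beta> > 0" using \<beta> n by (smt (verit) divide_nonneg_nonneg of_nat_0_le_iff)
  have \<beta>n: "real n + 4 \<le> real n * \<beta>"
    using \<beta> n by (simp add: field_simps)
  \<comment> \<open>The lower end of the admissible range decides the constant \<open>4\<close>: the
    deficit in \<open>real n - 1\<close> has to be compensated by the factor
    \<open>real n + 4\<close>. The upper end only needs
    \<open>real n + 2 \<le> real n * \<beta>\<close>.\<close>
  have "real n * real n \<le> (real n - 1) * (real n + 4)"
    using n by (simp add: algebra_simps)
  also have "\<dots> \<le> (2 * ?c) * (real n * \<beta>)"
    using c \<beta>n n by (intro mult_mono) auto
  finally have "real n * real n \<le> real n * (2 * ?c * \<beta>)" by (simp add: mult_ac)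
  then have "real n \<le> 2 * ?c * \<beta>" using n by (simp only: mult_le_cancel_left_pos)
  then have "real n / (2 * \<beta>) \<le> ?c" using \<beta>0 by (simp add: field_simps)
  moreover have "?c \<le> real n * \<beta> / 2" using c \<beta>n by simp
  ultimately show "\<sigma> \<in> sbm_labels n \<beta>"
    using \<sigma> hard_labels_subset by (auto simp: sbm_labels_def)
qed

text \<open>\<open>S\<close> is the exponent per entry, \<open>\<delta>\<close> allows for an
  affinity that is only approximately \<open>exp (- S n)\<close>, and \<open>K\<close> compares the
  second moment of \<open>h\<close> with \<open>S\<close>.\<close>

lemma minimax_risk_asymptotic_ge:
  fixes S \<delta> :: "nat \<Rightarrow> real" and K :: real
  assumes S: "filterlim (\<lambda>n. real n * S n) at_top sequentially"
    and \<delta>: "\<delta> \<longlonglongrightarrow> 0"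
    and ev: "\<forall>\<^sub>F n in sequentially. \<exists>Q h \<rho> v. tilted_entry (D n) Q h \<rho> v \<and>
      hard_labels n ((n - 3) div 6) \<subseteq> \<Theta> n \<and> \<Theta> n \<subseteq> labels n \<and>
      exp (- ((1 + \<delta> n) * S n)) \<le> \<rho> \<and> 0 \<le> \<delta> n \<and> v \<le> K * S n"
  shows "\<exists>\<eta> :: nat \<Rightarrow> real. \<eta> \<in> o(\<lambda>_. 1) \<and>
    (\<forall>\<^sub>F n in sequentially. minimax_risk n (D n) (\<Theta> n) \<ge> exp (- (1 + \<eta> n) * (real n * S n)))"
proof -
  define X where "X n = real n * S n" for n
  \<comment> \<open>The three losses relative to \<open>X\<close>: the affinity, the fluctuation of
    the log-likelihood ratio and the factor \<open>1 / 36\<close>.\<close>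
  define \<eta> where "\<eta> n = \<delta> n + sqrt (10 * K / X n) + ln 36 / X n" for n
  have X: "filterlim X at_top sequentially" using S unfolding X_def .
  have "(\<lambda>n. 10 * K / X n) \<longlonglongrightarrow> 0" "(\<lambda>n. ln 36 / X n) \<longlonglongrightarrow> 0"
    using X by (auto intro: tendsto_divide_0 filterlim_at_top_imp_at_infinity)
  then have "\<eta> \<longlonglongrightarrow> 0 + sqrt 0 + 0"
    unfolding \<eta>_def by (intro tendsto_add tendsto_real_sqrt \<delta>)
  then have "\<eta> \<in> o(\<lambda>_. 1)" by (intro smalloI_tendsto) auto
  moreover have "\<forall>\<^sub>F n in sequentially. minimax_risk n (D n) (\<Theta> n) \<ge> exp (- (1 + \<eta> n) * (real n * S n))"
    using ev eventually_ge_at_top[of 3] X[unfolded filterlim_at_top_dense, rule_format, of 0]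
  proof eventually_elim
    case (elim n)
    then obtain Q h \<rho> v where t: "tilted_entry (D n) Q h \<rho> v"
      and \<Theta>: "hard_labels n ((n - 3) div 6) \<subseteq> \<Theta> n" "\<Theta> n \<subseteq> labels n"
      and \<rho>: "exp (- ((1 + \<delta> n) * S n)) \<le> \<rho>" and \<delta>0: "0 \<le> \<delta> n" and v: "v \<le> K * S n" by blast
    interpret tilted_entry "D n" Q h \<rho> v by fact
    have n: "3 \<le> n" and X0: "X n > 0" using elim by auto
    then have S0: "S n > 0" by (auto simp: X_def zero_less_mult_iff)
    have "exp (- ((1 + \<delta> n) * X n)) \<le> exp (- (real (n - 1) * ((1 + \<delta> n) * S n)))"
      using \<delta>0 S0 n by (auto simp: X_def intro!: mult_right_mono)
    also have "\<dots> = exp (- ((1 + \<delta> n) * S n)) ^ (n - 1)"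
      by (simp add: exp_of_nat_mult[symmetric])
    also have "\<dots> \<le> \<rho> ^ (n - 1)" using \<rho> by (intro power_mono) auto
    finally have 1: "exp (- ((1 + \<delta> n) * X n)) \<le> \<rho> ^ (n - 1)" .
    \<comment> \<open>The factor \<open>10\<close> comes from
      \<open>n + 9 \<le> 10 * n\<close>.\<close>
    have "(real n + 9) * v \<le> (10 * real n) * (K * S n)"
      using n v v_nonneg by (intro mult_mono) auto
    also have "\<dots> = 10 * K / X n * (X n)\<^sup>2"
      using X0 by (simp add: power2_eq_square) (simp add: X_def)
    finally have "sqrt ((real n + 9) * v) \<le> sqrt (10 * K / X n * (X n)\<^sup>2)"
      by (rule real_sqrt_le_mono)
    also have "\<dots> = sqrt (10 * K / X n) * X n" using X0 by (simp only: real_sqrt_mult real_sqrt_abs abs_of_pos)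
    finally have 2: "exp (- (sqrt (10 * K / X n) * X n)) \<le> exp (- sqrt ((real n + 9) * v))" by simp
    have "- (1 + \<eta> n) * X n = - ln 36 + (- ((1 + \<delta> n) * X n) + - (sqrt (10 * K / X n) * X n))"
      using X0 by (simp add: \<eta>_def algebra_simps)
    then have "exp (- (1 + \<eta> n) * X n)
        = 1 / 36 * (exp (- ((1 + \<delta> n) * X n)) * exp (- (sqrt (10 * K / X n) * X n)))"
      by (simp only: exp_add) (simp add: exp_minus)
    also have "\<dots> \<le> 1 / 36 * (\<rho> ^ (n - 1) * exp (- sqrt ((real n + 9) * v)))"
      using 1 2 \<rho>_pos by (intro mult_left_mono mult_mono) auto
    also have "\<dots> \<le> minimax_risk n (D n) (\<Theta> n)"
      using n \<Theta> by (intro minimax_risk_ge)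
    finally show ?case by (simp add: X_def)
  qed
  ultimately show ?thesis by blast
qed

theorem theorem2:
  "(\<forall>\<tau> :: nat \<Rightarrow> real.
      (\<forall>n. \<tau> n > 0) \<longrightarrow>
      filterlim (\<lambda>n. real n * z2_snr (\<tau> n)) at_top sequentially \<longrightarrow>
      (\<exists>\<eta> :: nat \<Rightarrow> real. \<eta> \<in> o(\<lambda>_. 1) \<and>
        (\<forall>\<^sub>F n in sequentially.
           minimax_risk n (z2_entry (\<tau> n)) (labels n)
             \<ge> exp (- (1 + \<eta> n) * (real n * z2_snr (\<tau> n)))))) \<and>
   (\<forall>(\<alpha> :: nat \<Rightarrow> real) (\<epsilon> :: real).
      (\<forall>n. 0 < \<alpha> n \<and> \<alpha> n \<le> 1) \<longrightarrow> 0 < \<epsilon> \<longrightarrow> \<epsilon> < 1 / 2 \<longrightarrow>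
      (\<lambda>n. cbm_snr (\<alpha> n) \<epsilon>) \<in> o(\<lambda>_. 1) \<longrightarrow>
      filterlim (\<lambda>n. real n * cbm_snr (\<alpha> n) \<epsilon>) at_top sequentially \<longrightarrow>
      (\<exists>\<eta> :: nat \<Rightarrow> real. \<eta> \<in> o(\<lambda>_. 1) \<and>
        (\<forall>\<^sub>F n in sequentially.
           minimax_risk n (cbm_entry (\<alpha> n) \<epsilon>) (labels n)
             \<ge> exp (- (1 + \<eta> n) * (real n * cbm_snr (\<alpha> n) \<epsilon>))))) \<and>
   (\<exists>C > 0 :: real. \<forall>c\<^sub>0 :: real. 0 < c\<^sub>0 \<longrightarrow> c\<^sub>0 < 1 \<longrightarrow>
     (\<forall>(p :: nat \<Rightarrow> real) (q :: nat \<Rightarrow> real) (\<beta> :: nat \<Rightarrow> real).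
      (\<forall>n. 0 < q n \<and> q n < p n \<and> p n < 1 - c\<^sub>0) \<longrightarrow>
      (\<forall>n > 0. \<beta> n > 1 + C / real n) \<longrightarrow>
      filterlim (\<lambda>n. real n * sbm_snr (p n) (q n)) at_top sequentially \<longrightarrow>
      (\<exists>\<eta> :: nat \<Rightarrow> real. \<eta> \<in> o(\<lambda>_. 1) \<and>
        (\<forall>\<^sub>F n in sequentially.
           minimax_risk n (sbm_entry (p n) (q n)) (sbm_labels n (\<beta> n))
             \<ge> exp (- (1 + \<eta> n) * (real n / 2 * sbm_snr (p n) (q n)))))))"
proof (intro conjI allI impI)
  fix \<tau> :: "nat \<Rightarrow> real"
  assume \<tau>: "\<forall>n. \<tau> n > 0" and X: "filterlim (\<lambda>n. real n * z2_snr (\<tau> n)) at_top sequentially"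
  show "\<exists>\<eta> :: nat \<Rightarrow> real. \<eta> \<in> o(\<lambda>_. 1) \<and>
        (\<forall>\<^sub>F n in sequentially.
           minimax_risk n (z2_entry (\<tau> n)) (labels n)
             \<ge> exp (- (1 + \<eta> n) * (real n * z2_snr (\<tau> n))))"
  proof (rule minimax_risk_asymptotic_ge[OF X, where \<delta> = "\<lambda>_. 0" and K = 2])
    show "\<forall>\<^sub>F n in sequentially. \<exists>Q h \<rho> v. tilted_entry (z2_entry (\<tau> n)) Q h \<rho> v \<and>
      hard_labels n ((n - 3) div 6) \<subseteq> labels n \<and> labels n \<subseteq> labels n \<and>
      exp (- ((1 + 0) * z2_snr (\<tau> n))) \<le> \<rho> \<and> 0 \<le> (0 :: real) \<and> v \<le> 2 * z2_snr (\<tau> n)"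
    proof (rule always_eventually, rule allI)
      fix n
      show "\<exists>Q h \<rho> v. tilted_entry (z2_entry (\<tau> n)) Q h \<rho> v \<and>
        hard_labels n ((n - 3) div 6) \<subseteq> labels n \<and> labels n \<subseteq> labels n \<and>
        exp (- ((1 + 0) * z2_snr (\<tau> n))) \<le> \<rho> \<and> 0 \<le> (0 :: real) \<and> v \<le> 2 * z2_snr (\<tau> n)"
        by (intro exI conjI, rule tilted_entry_z2) (use \<tau> hard_labels_subset in auto)
    qed
  qed simp
next
  fix \<alpha> :: "nat \<Rightarrow> real" and \<epsilon> :: real
  assume \<alpha>: "\<forall>n. 0 < \<alpha> n \<and> \<alpha> n \<le> 1" and \<epsilon>: "0 < \<epsilon>" "\<epsilon> < 1 / 2"
    and small: "(\<lambda>n. cbm_snr (\<alpha> n) \<epsilon>) \<in> o(\<lambda>_. 1)"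
    and X: "filterlim (\<lambda>n. real n * cbm_snr (\<alpha> n) \<epsilon>) at_top sequentially"
  define I where "I n = cbm_snr (\<alpha> n) \<epsilon>" for n
  have I0: "0 \<le> I n" for n by (simp add: I_def cbm_snr_def)
  have I: "I \<longlonglongrightarrow> 0" using smalloD_tendsto[OF small] by (simp add: I_def[abs_def])
  \<comment> \<open>With this choice \<open>(1 + \<delta> n) * I n\<close> is
    \<open>inverse (1 - I n) - 1\<close>, so that \<open>ln x \<le> x - 1\<close> at
    \<open>x = inverse (1 - I n)\<close> gives the required bound on the affinity
    \<open>1 - I n\<close>.\<close>
  define \<delta> where "\<delta> n = I n / (1 - I n)" for n
  have \<delta>: "\<delta> \<longlonglongrightarrow> 0"
    using tendsto_divide[OF I tendsto_diff[OF tendsto_const[of 1] I]] by (simp add: \<delta>_def[abs_def])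
  show "\<exists>\<eta> :: nat \<Rightarrow> real. \<eta> \<in> o(\<lambda>_. 1) \<and>
        (\<forall>\<^sub>F n in sequentially.
           minimax_risk n (cbm_entry (\<alpha> n) \<epsilon>) (labels n)
             \<ge> exp (- (1 + \<eta> n) * (real n * cbm_snr (\<alpha> n) \<epsilon>)))"
  proof (rule minimax_risk_asymptotic_ge[OF X \<delta>, where K = 4])
    \<comment> \<open>Here \<open>I* = o(1)\<close> enters; it also gives
      \<open>2 * I n / (1 - I n) \<le> 4 * I n\<close>, hence \<open>K = 4\<close>.\<close>
    have "\<forall>\<^sub>F n in sequentially. I n < 1 / 2"
      using I by (rule order_tendstoD) simp
    then show "\<forall>\<^sub>F n in sequentially. \<exists>Q h \<rho> v. tilted_entry (cbm_entry (\<alpha> n) \<epsilon>) Q h \<rho> v \<and>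
      hard_labels n ((n - 3) div 6) \<subseteq> labels n \<and> labels n \<subseteq> labels n \<and>
      exp (- ((1 + \<delta> n) * cbm_snr (\<alpha> n) \<epsilon>)) \<le> \<rho> \<and> 0 \<le> \<delta> n \<and> v \<le> 4 * cbm_snr (\<alpha> n) \<epsilon>"
    proof eventually_elim
      case (elim n)
      have e: "exp (- ((1 + \<delta> n) * I n)) \<le> 1 - I n"
      proof -
        have "(1 + \<delta> n) * I n = inverse (1 - I n) - 1" using elim by (simp add: \<delta>_def field_simps)
        moreover have "ln (inverse (1 - I n)) \<le> inverse (1 - I n) - 1"
          using elim by (intro ln_le_minus_one) simp
        ultimately have "- ((1 + \<delta> n) * I n) \<le> ln (1 - I n)"
          using elim by (simp add: ln_inverse)
        then show ?thesis using elim by (simp add: ln_ge_iff)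
      qed
      have v: "2 * I n / (1 - I n) \<le> 4 * I n"
      proof -
        have "I n * I n \<le> I n * (1 / 2)" using elim I0 by (intro mult_left_mono) auto
        then show ?thesis using elim by (simp add: field_simps)
      qed
      have \<delta>0: "0 \<le> \<delta> n" using elim I0 by (simp add: \<delta>_def)
      have c: "0 < \<alpha> n" "\<alpha> n \<le> 1" "0 < 1 - cbm_snr (\<alpha> n) \<epsilon>" using \<alpha> elim by (auto simp: I_def)
      show ?case
        by (intro exI conjI, rule tilted_entry_cbm) (use \<delta>0 c hard_labels_subset[of n] e v \<epsilon> in \<open>auto simp: I_def\<close>)
    qed
  qed
next
  show "\<exists>C > 0 :: real. \<forall>c\<^sub>0 :: real. 0 < c\<^sub>0 \<longrightarrow> c\<^sub>0 < 1 \<longrightarrow>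
     (\<forall>(p :: nat \<Rightarrow> real) (q :: nat \<Rightarrow> real) (\<beta> :: nat \<Rightarrow> real).
      (\<forall>n. 0 < q n \<and> q n < p n \<and> p n < 1 - c\<^sub>0) \<longrightarrow>
      (\<forall>n > 0. \<beta> n > 1 + C / real n) \<longrightarrow>
      filterlim (\<lambda>n. real n * sbm_snr (p n) (q n)) at_top sequentially \<longrightarrow>
      (\<exists>\<eta> :: nat \<Rightarrow> real. \<eta> \<in> o(\<lambda>_. 1) \<and>
        (\<forall>\<^sub>F n in sequentially.
           minimax_risk n (sbm_entry (p n) (q n)) (sbm_labels n (\<beta> n))
             \<ge> exp (- (1 + \<eta> n) * (real n / 2 * sbm_snr (p n) (q n))))))"
  proof (intro exI[of _ 4] conjI allI impI)
    fix c\<^sub>0 :: real and p q \<beta> :: "nat \<Rightarrow> real"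
    assume c0: "0 < c\<^sub>0" "c\<^sub>0 < 1" and pq: "\<forall>n. 0 < q n \<and> q n < p n \<and> p n < 1 - c\<^sub>0"
      and \<beta>: "\<forall>n > 0. \<beta> n > 1 + 4 / real n"
      and X: "filterlim (\<lambda>n. real n * sbm_snr (p n) (q n)) at_top sequentially"
    \<comment> \<open>The affinity is \<open>exp (- sbm_snr p q / 2)\<close>, so the exponent per
      entry is half the signal-to-noise ratio; this yields \<open>n / 2\<close> in the
      theorem.\<close>
    have X': "filterlim (\<lambda>n. real n * (sbm_snr (p n) (q n) / 2)) at_top sequentially"
      using filterlim_tendsto_pos_mult_at_top[OF tendsto_const[of "1 / 2"] _ X] by simp
    have "\<exists>\<eta> :: nat \<Rightarrow> real. \<eta> \<in> o(\<lambda>_. 1) \<and>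
        (\<forall>\<^sub>F n in sequentially.
           minimax_risk n (sbm_entry (p n) (q n)) (sbm_labels n (\<beta> n))
             \<ge> exp (- (1 + \<eta> n) * (real n * (sbm_snr (p n) (q n) / 2))))"
    \<comment> \<open>The affinity is exact, so \<open>\<delta>\<close> is zero. Since
      \<open>\<rho> \<ge> 1 - p n \<ge> c\<^sub>0\<close>, the second moment is at most the
      signal-to-noise ratio over \<open>c\<^sub>0\<close>; the \<open>2\<close> in \<open>K\<close>
      undoes the halving.\<close>
    proof (rule minimax_risk_asymptotic_ge[OF X', where \<delta> = "\<lambda>_. 0" and K = "2 / c\<^sub>0"])
      show "\<forall>\<^sub>F n in sequentially. \<exists>Q h \<rho> v. tilted_entry (sbm_entry (p n) (q n)) Q h \<rho> v \<and>
        hard_labels n ((n - 3) div 6) \<subseteq> sbm_labels n (\<beta> n) \<and> sbm_labels n (\<beta> n) \<subseteq> labels n \<and>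
        exp (- ((1 + 0) * (sbm_snr (p n) (q n) / 2))) \<le> \<rho> \<and> 0 \<le> (0 :: real) \<and>
        v \<le> 2 / c\<^sub>0 * (sbm_snr (p n) (q n) / 2)"
        using eventually_ge_at_top[of 3]
      proof eventually_elim
        case (elim n)
        have pqn: "0 < q n" "p n < 1" "q n < p n" "c\<^sub>0 \<le> 1 - p n"
          using pq[rule_format, of n] c0 by auto
        define \<rho> where "\<rho> = sqrt (p n * q n) + sqrt ((1 - p n) * (1 - q n))"
        note t = tilted_entry_sbm[OF pqn(1-3), folded \<rho>_def]
        have "sbm_snr (p n) (q n) / \<rho> \<le> sbm_snr (p n) (q n) / c\<^sub>0"
          using t(2,4) pqn(4) c0 by (intro divide_left_mono) auto
        then have v: "sbm_snr (p n) (q n) / \<rho> \<le> 2 / c\<^sub>0 * (sbm_snr (p n) (q n) / 2)" by simp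
        have H: "hard_labels n ((n - 3) div 6) \<subseteq> sbm_labels n (\<beta> n)"
          using elim \<beta> by (intro hard_labels_subset_sbm_labels) auto
        have \<Theta>: "sbm_labels n (\<beta> n) \<subseteq> labels n" by (auto simp: sbm_labels_def)
        show ?case
          by (intro exI conjI, rule t(1)) (use H \<Theta> v t(3) in simp_all)
      qed
    qed simp
    then show "\<exists>\<eta> :: nat \<Rightarrow> real. \<eta> \<in> o(\<lambda>_. 1) \<and>
        (\<forall>\<^sub>F n in sequentially.
           minimax_risk n (sbm_entry (p n) (q n)) (sbm_labels n (\<beta> n))
             \<ge> exp (- (1 + \<eta> n) * (real n / 2 * sbm_snr (p n) (q n))))"
      by simp
  qed simp
qed

end
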